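(* Let $r\ge1$ and $s\ge0$ be integers, let $L>0$, and let $f:[0,1]\to\mathbb{R}$ satisfy condition $D_s$ with parameter $L$. Let $\hat f_r$ be the delete-$1$ $r$-jackknife estimator based on $n$ samples. Then there is a constant depending only on $r,s,L$ such that, up to this constant factor, $$\|\mathbb{E}_p\hat f_r-f(p)\|\lesssim_{r,s,L}\begin{cases}n^{r-s-1}&\text{if }0\le s\le2r-2,\\ n^{-(r-\frac12)}&\text{if }s=2r-1,\\ n^{-r}&\text{if }s\ge2r.\end{cases}$$
   Context: All norms are supremum norms over $[0,1]$ (in $p$). $a\lesssim_\theta b$ means $a\le Mb$ for all $n$ with a constant $M$ depending only on $\theta$. Condition $D_s$ with parameter $L$: for $s=0$, $f$ is Lebesgue integrable on $[0,1]$ and $\sup_{x\in[0,1]}|f(x)|\le L$; for $s\ge1$, $f^{(s-1)}$ is absolutely continuous on $[0,1]$ and $\sup_{x\in[0,1]}|f^{(i)}(x)|\le L$ for $0\le i\le s$. The delete-$1$ $r$-jackknife (defined for $n\ge r$) uses $n_i=n-r+i$ and $C_i=\prod_{j\ne i}\frac{n_i}{n_i-n_j}$, $1\le i\le r$; it is the estimator $\hat f_r=\sum_{i=1}^r C_i\,\mathbb{U}_{n,i}$, where $\mathbb{U}_{n,i}$ is the average of $f\big(\frac1{n_i}\sum_{k\in S}X_k\big)$ over all subsets $S\subset\{1,\dots,n\}$ of size $n_i$, and $X_1,\dots,X_n$ are i.i.d. $\mathrm{Bernoulli}(p)$. Thus $\mathbb{E}_p\hat f_r=\sum_{i=1}^rC_i\,\mathbb{E}_pf(\hat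 p_{n_i})$, where $m\hat p_m\sim\mathrm{Binomial}(m,p)$. *)

theory Defs
  imports "HOL-Probability.Probability"
begin

text \<open>The supremum norm over \<open>[0,1]\<close>, taken in the extended reals so that it is \<open>\<infinity>\<close> for
  unbounded functions.\<close>

definition sup_norm01 :: "(real \<Rightarrow> real) \<Rightarrow> ereal" where
  "sup_norm01 g = (SUP x\<in>{0..1}. ereal \<bar>g x\<bar>)"

text \<open>A finite family of non-overlapping subintervals of \<open>[a,b]\<close> is given by the set of its endpoint
  pairs.\<close>

definition abs_continuous_on_interval :: "real \<Rightarrow> real \<Rightarrow> (real \<Rightarrow> real) \<Rightarrow> bool" where
  "abs_continuous_on_interval a b g \<longleftrightarrow>
     (\<forall>\<epsilon>>0. \<exists>\<delta>>0. \<forall>I :: (real \<times> real) set.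
        finite I \<and>
        (\<forall>(u, v)\<in>I. a \<le> u \<and> u \<le> v \<and> v \<le> b) \<and>
        pairwise (\<lambda>(u, v) (u', v'). {u<..<v} \<inter> {u'<..<v'} = {}) I \<and>
        (\<Sum>(u, v)\<in>I. v - u) < \<delta>
        \<longrightarrow> (\<Sum>(u, v)\<in>I. \<bar>g v - g u\<bar>) < \<epsilon>)"

text \<open>The \<open>i\<close>-th derivative on \<open>[0,1]\<close>, one-sided at the endpoints. A value is meaningful only where
  the function of order \<open>i - 1\<close> is differentiable.\<close>

definition deriv01 :: "nat \<Rightarrow> (real \<Rightarrow> real) \<Rightarrow> real \<Rightarrow> real" where
  "deriv01 i f = ((\<lambda>g x. vector_derivative g (at x within {0..1})) ^^ i) f"

text \<open>For \<open>s \<ge> 1\<close>, the absolutely continuous function \<open>f\<^sup>(\<^sup>s\<^sup>-\<^sup>1\<^sup>)\<close> is differentiable only almost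
  everywhere in general, so the bound on the derivative of top order \<open>s\<close> is imposed almost
  everywhere; the lower derivatives exist and are bounded at every point of \<open>[0,1]\<close>.\<close>

definition condition_D :: "nat \<Rightarrow> real \<Rightarrow> (real \<Rightarrow> real) \<Rightarrow> bool" where
  "condition_D s L f \<longleftrightarrow>
     (if s = 0 then
        f absolutely_integrable_on {0..1} \<and> (\<forall>x\<in>{0..1}. \<bar>f x\<bar> \<le> L)
      else
        (\<forall>i<s - 1. \<forall>x\<in>{0..1}. deriv01 i f differentiable (at x within {0..1})) \<and>
        abs_continuous_on_interval 0 1 (deriv01 (s - 1) f) \<and>
        (\<forall>i<s. \<forall>x\<in>{0..1}. \<bar>deriv01 i f x\<bar> \<le> L) \<and>
        (AE x in lebesgue_on {0..1}.
           deriv01 (s - 1) f differentiable (at x within {0..1}) \<and> \<bar>deriv01 s f x\<bar> \<le> L))"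

text \<open>The subsample sizes \<open>n\<^sub>i\<close>; only used for \<open>n \<ge> r\<close>, where the subtraction does not truncate.\<close>

definition jk_size :: "nat \<Rightarrow> nat \<Rightarrow> nat \<Rightarrow> nat" where
  "jk_size r n i = n - r + i"

definition jk_coeff :: "nat \<Rightarrow> nat \<Rightarrow> nat \<Rightarrow> real" where
  "jk_coeff r n i =
     (\<Prod>j\<in>{1..r} - {i}. real (jk_size r n i) / (real (jk_size r n i) - real (jk_size r n j)))"

definition subsample_average :: "nat \<Rightarrow> nat \<Rightarrow> (real \<Rightarrow> real) \<Rightarrow> (nat \<Rightarrow> real) \<Rightarrow> real" where
  "subsample_average n m f X =
     (\<Sum>S | S \<subseteq> {1..n} \<and> card S = m. f ((\<Sum>k\<in>S. X k) / real m)) /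
     real (card {S. S \<subseteq> {1..n} \<and> card S = m})"

definition jackknife :: "nat \<Rightarrow> nat \<Rightarrow> (real \<Rightarrow> real) \<Rightarrow> (nat \<Rightarrow> real) \<Rightarrow> real" where
  "jackknife r n f X = (\<Sum>i=1..r. jk_coeff r n i * subsample_average n (jk_size r n i) f X)"

definition bernoulli_samples :: "nat \<Rightarrow> real \<Rightarrow> (nat \<Rightarrow> bool) pmf" where
  "bernoulli_samples n p = Pi_pmf {1..n} False (\<lambda>_. bernoulli_pmf p)"

definition jackknife_mean :: "nat \<Rightarrow> nat \<Rightarrow> (real \<Rightarrow> real) \<Rightarrow> real \<Rightarrow> real" where
  "jackknife_mean r n f p =
     measure_pmf.expectation (bernoulli_samples n p) (\<lambda>X. jackknife r n f (\<lambda>k. of_bool (X k)))"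

definition jackknife_rate :: "nat \<Rightarrow> nat \<Rightarrow> nat \<Rightarrow> real" where
  "jackknife_rate r s n =
     (if s + 2 \<le> 2 * r then real n powr (real r - real s - 1)
      else if s + 1 = 2 * r then real n powr (- (real r - 1 / 2))
      else real n powr (- real r))"

end

theory Submission
  imports Defs
begin

text \<open>
  Put \<open>q = r - 1\<close> and \<open>N = n - q\<close>. The jackknife coefficients turn \<open>\<Sum>\<^sub>i C\<^sub>i F(n\<^sub>i)\<close> into the \<open>q\<close>-th forward
  difference of \<open>x\<^sup>q F(x) / q!\<close> at \<open>N\<close>, so it reproduces constants, annihilates \<open>1/m, \<dots>, 1/m\<^sup>q\<close>, and
  maps \<open>1/m\<^sup>d\<close> with \<open>d > q\<close> to \<open>O(N\<^sup>-\<^sup>d)\<close>. Write \<open>f = P + R\<close> with \<open>P\<close> the Taylor polynomial of degree \<open>s - 1\<close>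
  at \<open>p\<close>. The central moments of the sample mean are polynomials in \<open>1/m\<close> without constant term, so \<open>P\<close>
  contributes \<open>O(N\<^sup>-\<^sup>r)\<close>. For \<open>R\<close>, expand around the mean \<open>w\<close> of the first \<open>N\<close> samples: the other
  \<open>t \<le> q\<close> samples move the mean by \<open>O(1/N)\<close>, hence the Taylor error is \<open>O(N\<^sup>q \<cdot> N\<^sup>-\<^sup>s)\<close>. In the term of
  order \<open>k\<close>, the moment \<open>Q\<^sub>k(t) = E (\<Sum>\<^sub>d\<^sub>\<le>\<^sub>t (X\<^sub>d - w))\<^sup>k\<close> has \<open>b\<close>-th difference \<open>O(\<bar>p - w\<bar>\<^bsup>2b - k\<^esup>)\<close> at \<open>0\<close>,
  so by the Leibniz rule it contributes at most \<open>N\<^bsup>b - k\<^esup> E \<bar>p - w\<bar>\<^bsup>(s - k) + (2b - k)\<^esup> = O(N\<^bsup>-s/2\<^esup>)\<close> for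
  each \<open>b \<le> q\<close>. All three rates \<open>N\<^bsup>-r\<^esup>\<close>, \<open>N\<^bsup>-s/2\<^esup>\<close> and \<open>N\<^bsup>r - 1 - s\<^esup>\<close> are dominated by the claimed one.
\<close>

subsection \<open>Forward differences\<close>

text \<open>The domain is polymorphic because moments are differenced in a natural sample count and
  powers over the reals, where the mean value theorem applies.\<close>

definition fdiff :: "('a::semiring_1 \<Rightarrow> real) \<Rightarrow> 'a \<Rightarrow> real" where
  "fdiff g x = g (x + 1) - g x"

text \<open>Pascal's rule in summed form; it carries the inductions for the explicit formula, the
  Leibniz rule and Newton's formula.\<close>

lemma sum_choose_Suc:
  fixes a :: "nat \<Rightarrow> real"
  shows "(\<Sum>b\<le>Suc m. real (Suc m choose b) * a b) =
    (\<Sum>b\<le>m. real (m choose b) * a (Suc b)) + (\<Sum>b\<le>m. real (m choose b) * a b)"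
proof -
  have "(\<Sum>b\<le>Suc m. real (Suc m choose b) * a b) =
      (\<Sum>b\<le>m. real (m choose b) * a (Suc b)) +
      (a 0 + (\<Sum>b\<le>m. real (m choose Suc b) * a (Suc b)))"
    by (simp add: sum.atMost_Suc_shift sum.distrib algebra_simps del: sum.atMost_Suc)
  also have "a 0 + (\<Sum>b\<le>m. real (m choose Suc b) * a (Suc b)) = (\<Sum>b\<le>Suc m. real (m choose b) * a b)"
    by (simp add: sum.atMost_Suc_shift del: sum.atMost_Suc)
  also have "\<dots> = (\<Sum>b\<le>m. real (m choose b) * a b)"
    by simp
  finally show ?thesis by simp
qed

lemma fdiff_funpow_Suc: "(fdiff ^^ Suc m) g x = (fdiff ^^ m) g (x + 1) - (fdiff ^^ m) g x"
  by (simp add: fdiff_def)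

lemma fdiff_funpow_eq_sum:
  "(fdiff ^^ m) g x = (\<Sum>t\<le>m. (-1) ^ (m - t) * real (m choose t) * g (x + of_nat t))"
proof (induction m arbitrary: x)
  case 0
  then show ?case by simp
next
  case (Suc m)
  let ?a = "\<lambda>t. (-1) ^ (Suc m - t) * g (x + of_nat t)"
  have "(\<Sum>t\<le>Suc m. (-1) ^ (Suc m - t) * real (Suc m choose t) * g (x + of_nat t)) =
      (\<Sum>t\<le>Suc m. real (Suc m choose t) * ?a t)"
    by (intro sum.cong) (auto simp: algebra_simps)
  also have "\<dots> = (\<Sum>b\<le>m. real (m choose b) * ?a (Suc b)) + (\<Sum>b\<le>m. real (m choose b) * ?a b)"
    by (rule sum_choose_Suc)
  also have "(\<Sum>b\<le>m. real (m choose b) * ?a (Suc b)) = (fdiff ^^ m) g (x + 1)"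
    unfolding Suc.IH by (intro sum.cong) (auto simp: algebra_simps)
  also have "(\<Sum>b\<le>m. real (m choose b) * ?a b) = - (fdiff ^^ m) g x"
    unfolding Suc.IH sum_negf[symmetric]
    by (intro sum.cong) (auto simp: Suc_diff_le)
  finally show ?case
    unfolding fdiff_funpow_Suc by linarith
qed

lemma fdiff_funpow_add:
  "(fdiff ^^ m) (\<lambda>x. g x + h x) x = (fdiff ^^ m) g x + (fdiff ^^ m) h x"
  by (simp add: fdiff_funpow_eq_sum sum.distrib algebra_simps)

lemma fdiff_funpow_sum:
  "(fdiff ^^ m) (\<lambda>x. \<Sum>j\<in>J. c j * g j x) x = (\<Sum>j\<in>J. c j * (fdiff ^^ m) (g j) x)"
proof -
  have "(fdiff ^^ m) (\<lambda>x. \<Sum>j\<in>J. c j * g j x) x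
      = (\<Sum>t\<le>m. \<Sum>j\<in>J. c j * ((-1) ^ (m - t) * real (m choose t) * g j (x + of_nat t)))"
    unfolding fdiff_funpow_eq_sum by (simp add: sum_distrib_left algebra_simps)
  also have "\<dots> = (\<Sum>j\<in>J. \<Sum>t\<le>m. c j * ((-1) ^ (m - t) * real (m choose t) * g j (x + of_nat t)))"
    by (rule sum.swap)
  finally show ?thesis
    by (simp add: fdiff_funpow_eq_sum sum_distrib_left)
qed

lemma fdiff_funpow_shift: "(fdiff ^^ m) (\<lambda>x. g (x + c)) x = (fdiff ^^ m) g (x + c)"
  by (simp add: fdiff_funpow_eq_sum algebra_simps)

text \<open>Discrete Leibniz rule: in the product rule for one difference, a difference that falls
  on \<open>v\<close> shifts the argument of \<open>u\<close> by one.\<close>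

lemma fdiff_funpow_mult:
  "(fdiff ^^ m) (\<lambda>x. u x * v x) x =
    (\<Sum>b\<le>m. real (m choose b) * ((fdiff ^^ (m - b)) u (x + of_nat b) * (fdiff ^^ b) v x))"
proof (induction m arbitrary: u v)
  case 0
  then show ?case by simp
next
  case (Suc m)
  have Suc_right: "(fdiff ^^ k) (fdiff g) = (fdiff ^^ Suc k) g" for k and g :: "'a \<Rightarrow> real"
    by (simp add: funpow_swap1)
  have "fdiff (\<lambda>x. u x * v x) = (\<lambda>x. u (x + 1) * fdiff v x + fdiff u x * v x)"
    by (auto simp: fdiff_def algebra_simps)
  then have "(fdiff ^^ Suc m) (\<lambda>x. u x * v x) x =
     (fdiff ^^ m) (\<lambda>x. u (x + 1) * fdiff v x) x + (fdiff ^^ m) (\<lambda>x. fdiff u x * v x) x"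
    by (simp only: Suc_right[symmetric] fdiff_funpow_add)
  also have "(fdiff ^^ m) (\<lambda>x. u (x + 1) * fdiff v x) x =
     (\<Sum>b\<le>m. real (m choose b) * ((fdiff ^^ (m - b)) u (x + of_nat b + 1) * (fdiff ^^ Suc b) v x))"
    unfolding Suc.IH Suc_right fdiff_funpow_shift ..
  also have "(fdiff ^^ m) (\<lambda>x. fdiff u x * v x) x =
     (\<Sum>b\<le>m. real (m choose b) * ((fdiff ^^ (Suc m - b)) u (x + of_nat b) * (fdiff ^^ b) v x))"
    unfolding Suc.IH Suc_right by (intro sum.cong) (auto simp: Suc_diff_le)
  finally show ?case
    unfolding sum_choose_Suc by (simp add: algebra_simps)
qed

text \<open>The shift by one is the identity plus \<open>fdiff\<close>, and its \<open>m\<close>-th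
  power expands binomially.\<close>

lemma newton_forward:
  "g (x + of_nat m) = (\<Sum>b\<le>m. real (m choose b) * (fdiff ^^ b) g x)"
proof (induction m arbitrary: g)
  case 0
  then show ?case by simp
next
  case (Suc m)
  have "g (x + of_nat (Suc m)) = fdiff g (x + of_nat m) + g (x + of_nat m)"
    by (simp add: fdiff_def algebra_simps)
  also have "\<dots> = (\<Sum>b\<le>m. real (m choose b) * (fdiff ^^ Suc b) g x) +
      (\<Sum>b\<le>m. real (m choose b) * (fdiff ^^ b) g x)"
    unfolding Suc.IH by (simp add: funpow_swap1)
  finally show ?case unfolding sum_choose_Suc .
qed

section \<open>Differences of real powers\<close>

lemma has_real_derivative_fdiff_funpow:
  fixes g g' :: "real \<Rightarrow> real"
  assumes "\<And>y. y > 0 \<Longrightarrow> (g has_real_derivative g' y) (at y)" and "x > 0"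
  shows "((fdiff ^^ a) g has_real_derivative (fdiff ^^ a) g' x) (at x)"
  using assms(2)
proof (induction a arbitrary: x)
  case 0
  then show ?case using assms(1) by simp
next
  case (Suc a)
  have "((\<lambda>x. (fdiff ^^ a) g (x + 1)) has_real_derivative (fdiff ^^ a) g' (x + 1)) (at x)"
    using Suc.IH[of "x + 1"] Suc.prems by (simp add: DERIV_shift)
  then have "((\<lambda>x. (fdiff ^^ a) g (x + 1) - (fdiff ^^ a) g x) has_real_derivative
      (fdiff ^^ a) g' (x + 1) - (fdiff ^^ a) g' x) (at x)"
    using Suc.IH[OF Suc.prems] by (rule DERIV_diff)
  moreover have "(fdiff ^^ Suc a) g = (\<lambda>x. (fdiff ^^ a) g (x + 1) - (fdiff ^^ a) g x)"
    by (rule ext) (rule fdiff_funpow_Suc)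
  ultimately show ?case by (simp only: fdiff_funpow_Suc)
qed

text \<open>By the mean value theorem each difference acts as a derivative at a point less than one
  further right; it lowers the exponent by one and contributes one factor of the product.\<close>

lemma fdiff_powr_mean_value:
  fixes x e :: real
  assumes "x > 0"
  shows "\<exists>\<xi>\<in>{x..x + real a}. (fdiff ^^ a) (\<lambda>y. y powr e) x = (\<Prod>i<a. e - real i) * \<xi> powr (e - real a)"
  using assms
proof (induction a arbitrary: e x)
  case 0
  then show ?case by simp
next
  case (Suc a)
  let ?h = "(fdiff ^^ a) (\<lambda>y. y powr e)"
  let ?h' = "(fdiff ^^ a) (\<lambda>y. e * y powr (e - 1))"
  have d: "(?h has_real_derivative ?h' y) (at y)" if "y > 0" for y
    by (intro has_real_derivative_fdiff_funpow that) (auto intro!: derivative_eq_intros)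
  \<comment> \<open>Only the outermost difference is resolved; the derivative of the other
    \<open>a\<close> differences is again such a difference, with exponent
    \<open>e - 1\<close>.\<close>
  obtain z where z: "x < z" "z < x + 1" "?h (x + 1) - ?h x = (x + 1 - x) * ?h' z"
    using MVT2[of x "x + 1" ?h ?h'] d Suc.prems by force
  have "?h' z = e * (fdiff ^^ a) (\<lambda>y. y powr (e - 1)) z"
    by (simp add: fdiff_funpow_eq_sum sum_distrib_left algebra_simps)
  moreover obtain \<xi> where \<xi>: "\<xi> \<in> {z..z + real a}"
    "(fdiff ^^ a) (\<lambda>y. y powr (e - 1)) z = (\<Prod>i<a. e - 1 - real i) * \<xi> powr (e - 1 - real a)"
    using Suc.IH[of z "e - 1"] z(1) Suc.prems by auto
  moreover have "(\<Prod>i<Suc a. e - real i) = e * (\<Prod>i<a. e - 1 - real i)"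
    by (simp add: prod.lessThan_Suc_shift algebra_simps del: prod.lessThan_Suc)
  ultimately have "(fdiff ^^ Suc a) (\<lambda>y. y powr e) x =
      (\<Prod>i<Suc a. e - real i) * \<xi> powr (e - real (Suc a))"
    using z(3) by (simp add: fdiff_def algebra_simps)
  moreover have "\<xi> \<in> {x..x + real (Suc a)}"
    using \<xi>(1) z by auto
  ultimately show ?case by blast
qed

text \<open>The absolute value in the exponent treats both signs at once: for \<beta> \<ge> 0 the
  factor is needed, for \<beta> < 0 the power decreases and \<open>c \<ge> 1\<close>.\<close>

lemma powr_le_comparable:
  fixes \<xi> c \<beta> N :: real
  assumes "N > 0" "N \<le> \<xi>" "\<xi> \<le> c * N"
  shows "\<xi> powr \<beta> \<le> c powr \<bar>\<beta>\<bar> * N powr \<beta>"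
proof -
  have c: "c \<ge> 1"
    using assms by (metis dual_order.trans mult_le_cancel_right1 not_less)
  show ?thesis
  proof (cases "\<beta> \<ge> 0")
    case True
    have "\<xi> powr \<beta> \<le> (c * N) powr \<beta>"
      using True assms by (intro powr_mono2) auto
    then show ?thesis using True c assms by (simp add: powr_mult)
  next
    case False
    have "\<xi> powr \<beta> \<le> N powr \<beta>"
      using False assms by (intro powr_mono2') auto
    also have "\<dots> \<le> c powr \<bar>\<beta>\<bar> * N powr \<beta>"
      using c by (simp add: ge_one_powr_ge_zero mult_le_cancel_right1)
    finally show ?thesis .
  qed
qed

subsection \<open>Moments of Bernoulli sums\<close>

lemma abs_sum_le:
  fixes f :: "'b \<Rightarrow> real"
  assumes "\<And>i. i \<in> A \<Longrightarrow> \<bar>f i\<bar> \<le> g i"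
  shows "\<bar>sum f A\<bar> \<le> sum g A"
  using order_trans[OF sum_abs sum_mono[OF assms]] .

text \<open>The binomial expectation of \<open>g\<close>; in recursive form, conditioning on the first samples is an induction.\<close>

primrec bern_exp :: "real \<Rightarrow> nat \<Rightarrow> (nat \<Rightarrow> real) \<Rightarrow> real" where
  "bern_exp p 0 g = g 0"
| "bern_exp p (Suc m) g = p * bern_exp p m (\<lambda>j. g (Suc j)) + (1 - p) * bern_exp p m g"

lemma bern_exp_sum: "bern_exp p m (\<lambda>j. \<Sum>i\<in>I. c i * g i j) = (\<Sum>i\<in>I. c i * bern_exp p m (g i))"
  by (induction m arbitrary: g) (simp_all add: sum_distrib_left sum.distrib[symmetric] algebra_simps)

lemma bern_exp_add: "bern_exp p m (\<lambda>j. g j + h j) = bern_exp p m g + bern_exp p m h"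
  by (induction m arbitrary: g h) (simp_all add: algebra_simps)

lemma bern_exp_diff: "bern_exp p m (\<lambda>j. g j - h j) = bern_exp p m g - bern_exp p m h"
  using bern_exp_add[of p m "\<lambda>j. g j - h j" h] by simp

lemma bern_exp_cmult: "bern_exp p m (\<lambda>j. c * g j) = c * bern_exp p m g"
  by (induction m arbitrary: g) (simp_all add: algebra_simps)

lemma bern_exp_const [simp]: "bern_exp p m (\<lambda>j. c) = c"
  by (induction m) (simp_all add: algebra_simps)

lemma bern_exp_mono:
  assumes "p \<in> {0..1}" and "\<And>j. j \<le> m \<Longrightarrow> g j \<le> h j"
  shows "bern_exp p m g \<le> bern_exp p m h"
  using assms(2)
proof (induction m arbitrary: g h)
  case 0
  then show ?case by simp
next
  case (Suc m)
  have "bern_exp p m (\<lambda>j. g (Suc j)) \<le> bern_exp p m (\<lambda>j. h (Suc j))" "bern_exp p m g \<le> bern_exp p m h"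
    using Suc.prems by (auto intro!: Suc.IH)
  then show ?case
    using assms(1) by (auto intro!: add_mono mult_left_mono)
qed

lemma bern_exp_cong: "(\<And>j. j \<le> m \<Longrightarrow> g j = h j) \<Longrightarrow> bern_exp p m g = bern_exp p m h"
proof (induction m arbitrary: g h)
  case (Suc m)
  have "bern_exp p m (\<lambda>j. g (Suc j)) = bern_exp p m (\<lambda>j. h (Suc j))" "bern_exp p m g = bern_exp p m h"
    using Suc.prems by (auto intro!: Suc.IH)
  then show ?case by simp
qed simp

lemma abs_bern_exp_le:
  assumes "p \<in> {0..1}" and "\<And>j. j \<le> m \<Longrightarrow> \<bar>g j\<bar> \<le> h j"
  shows "\<bar>bern_exp p m g\<bar> \<le> bern_exp p m h"
proof (rule abs_leI)
  show "bern_exp p m g \<le> bern_exp p m h"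
    using assms by (intro bern_exp_mono) (auto dest: abs_le_D1)
  have "bern_exp p m (\<lambda>j. (-1) * g j) \<le> bern_exp p m h"
    using assms by (intro bern_exp_mono) (auto dest: abs_le_D2)
  then show "- bern_exp p m g \<le> bern_exp p m h"
    unfolding bern_exp_cmult by simp
qed

text \<open>Conditioning on the first \<open>m\<close> samples: \<open>j\<close> counts their
  successes and \<open>i\<close> those of the other \<open>t\<close>.\<close>

lemma bern_exp_split: "bern_exp p (m + t) g = bern_exp p m (\<lambda>j. bern_exp p t (\<lambda>i. g (j + i)))"
  by (induction m arbitrary: g) (simp_all)

lemma expectation_binomial_pmf_eq_bern_exp:
  assumes "p \<in> {0..1}"
  shows "measure_pmf.expectation (binomial_pmf m p) g = bern_exp p m g"
proof (induction m arbitrary: g)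
  case 0
  then show ?case using assms by (simp add: binomial_pmf_0)
next
  case (Suc m)
  have "measure_pmf.expectation (binomial_pmf (Suc m) p) g =
      (\<Sum>b\<in>UNIV. pmf (bernoulli_pmf p) b *\<^sub>R
         measure_pmf.expectation (map_pmf (\<lambda>k. (if b then 1 else 0) + k) (binomial_pmf m p)) g)"
    unfolding binomial_pmf_Suc[OF assms] map_pmf_def
    using assms by (intro pmf_expectation_bind) (auto simp: set_pmf_binomial_eq)
  also have "\<dots> = bern_exp p (Suc m) g"
    using assms by (simp add: Suc.IH UNIV_bool)
  finally show ?case .
qed

section \<open>Moments about an arbitrary centre\<close>

text \<open>The centre is free: \<open>w = p\<close> gives the central moments, and the mean of the
  first \<open>N\<close> samples as \<open>w\<close> gives the moments in the Taylor
  remainder.\<close>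

definition bern_moment :: "real \<Rightarrow> real \<Rightarrow> nat \<Rightarrow> nat \<Rightarrow> real" where
  "bern_moment p w k t = bern_exp p t (\<lambda>i. (real i - real t * w) ^ k)"

lemma bern_moment_0: "bern_moment p w k 0 = 0 ^ k"
  by (simp add: bern_moment_def)

text \<open>Split off one draw, worth \<open>1 - w\<close> with probability \<open>p\<close> and
  \<open>- w\<close> otherwise, and expand binomially; the factor next to \<open>k choose j\<close>
  is the \<open>j\<close>-th moment of this draw.\<close>

lemma bern_moment_Suc:
  "bern_moment p w k (Suc t) =
    (\<Sum>j\<le>k. (real (k choose j) * (p * (1 - w) ^ j + (1 - p) * (- w) ^ j)) * bern_moment p w (k - j) t)"
proof -
  have e: "bern_exp p t (\<lambda>i. (c + (real i - real t * w)) ^ k)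
      = (\<Sum>j\<le>k. (real (k choose j) * c ^ j) * bern_moment p w (k - j) t)" for c
    unfolding binomial_ring bern_moment_def bern_exp_sum by simp
  have "bern_moment p w k (Suc t) = p * bern_exp p t (\<lambda>i. ((1 - w) + (real i - real t * w)) ^ k)
     + (1 - p) * bern_exp p t (\<lambda>i. (- w + (real i - real t * w)) ^ k)"
    unfolding bern_moment_def by (simp add: algebra_simps)
  also have "\<dots> = (\<Sum>j\<le>k. (real (k choose j) * (p * (1 - w) ^ j + (1 - p) * (- w) ^ j)) * bern_moment p w (k - j) t)"
    unfolding e by (simp add: sum_distrib_left sum.distrib[symmetric] algebra_simps)
  finally show ?thesis .
qed

text \<open>A difference in \<open>t\<close> cancels the term \<open>j = 0\<close> of the recursion,
  so it lowers the order \<open>k\<close> by some \<open>j \<ge> 1\<close>, and a step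
  \<open>j = 1\<close> brings the factor \<open>p - w\<close>. At \<open>t = 0\<close> only order 0
  survives; reaching it from \<open>k\<close> in \<open>b\<close> steps takes at least
  \<open>2 * b - k\<close> steps of size one.\<close>

lemma abs_fdiff_bern_moment_le:
  assumes p: "p \<in> {0..1}" and w: "w \<in> {0..1}"
  shows "\<bar>(fdiff ^^ b) (bern_moment p w k) 0\<bar> \<le> real b ^ k * \<bar>p - w\<bar> ^ (2 * b - k)"
proof (induction b arbitrary: k)
  case 0
  then show ?case by (simp add: bern_moment_0 power_0_left)
next
  case (Suc b)
  define \<mu> where "\<mu> j = p * (1 - w) ^ j + (1 - p) * (- w) ^ j" for j
  have \<mu>0: "\<mu> 0 = 1" and \<mu>1: "\<mu> 1 = p - w"
    by (simp_all add: \<mu>_def algebra_simps)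
  have \<mu>: "\<bar>\<mu> j\<bar> \<le> 1" for j
  proof -
    have "\<bar>\<mu> j\<bar> \<le> p * \<bar>(1 - w) ^ j\<bar> + (1 - p) * \<bar>(- w) ^ j\<bar>"
      unfolding \<mu>_def using p by (intro order_trans[OF abs_triangle_ineq]) (simp add: abs_mult)
    also have "\<dots> \<le> p * 1 + (1 - p) * 1"
      using p w by (intro add_mono mult_left_mono) (auto simp: power_abs power_le_one)
    finally show ?thesis by simp
  qed
  have pw: "\<bar>p - w\<bar> \<le> 1" using p w by auto
  have "fdiff (bern_moment p w k) t =
      (\<Sum>j\<in>{1..k}. (real (k choose j) * \<mu> j) * bern_moment p w (k - j) t)" for t
  proof -
    have "(\<Sum>j\<le>k. (real (k choose j) * \<mu> j) * bern_moment p w (k - j) t) =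
       bern_moment p w k t + (\<Sum>j\<in>{1..k}. (real (k choose j) * \<mu> j) * bern_moment p w (k - j) t)"
    proof -
      have "{..k} = insert 0 {1..k}" by auto
      then show ?thesis by (simp add: \<mu>0)
    qed
    then show ?thesis
      by (simp add: fdiff_def bern_moment_Suc \<mu>_def)
  qed
  then have fd: "fdiff (bern_moment p w k) =
      (\<lambda>t. \<Sum>j\<in>{1..k}. (real (k choose j) * \<mu> j) * bern_moment p w (k - j) t)" ..
  have "(fdiff ^^ Suc b) (bern_moment p w k) 0 =
      (\<Sum>j\<in>{1..k}. (real (k choose j) * \<mu> j) * (fdiff ^^ b) (bern_moment p w (k - j)) 0)"
    unfolding funpow_Suc_right o_apply fd fdiff_funpow_sum ..
  then have "\<bar>(fdiff ^^ Suc b) (bern_moment p w k) 0\<bar> \<le>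
      (\<Sum>j\<in>{1..k}. real (k choose j) * (\<bar>\<mu> j\<bar> * \<bar>(fdiff ^^ b) (bern_moment p w (k - j)) 0\<bar>))"
    by (auto intro!: order_trans[OF sum_abs] sum_mono simp: abs_mult)
  also have "\<dots> \<le> (\<Sum>j\<in>{1..k}. real (k choose j) * (real b ^ (k - j) * \<bar>p - w\<bar> ^ (2 * Suc b - k)))"
  proof (intro sum_mono mult_left_mono)
    fix j assume j: "j \<in> {1..k}"
    have "\<bar>\<mu> j\<bar> * \<bar>p - w\<bar> ^ (2 * b - (k - j)) \<le> \<bar>p - w\<bar> ^ (2 * Suc b - k)"
    \<comment> \<open>A step \<open>j = 1\<close> raises the exponent by one and its factor supplies
      another one; a step \<open>j \<ge> 2\<close> raises it by at least two. Truncated subtraction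
      is harmless since \<open>\<bar>p - w\<bar> \<le> 1\<close>.\<close>
    proof (cases "j = 1")
      case True
      have "\<bar>\<mu> j\<bar> * \<bar>p - w\<bar> ^ (2 * b - (k - j)) = \<bar>p - w\<bar> ^ Suc (2 * b - (k - j))"
        using True \<mu>1 by simp
      also have "\<dots> \<le> \<bar>p - w\<bar> ^ (2 * Suc b - k)"
        using pw j True by (intro power_decreasing) auto
      finally show ?thesis .
    next
      case False
      have "\<bar>\<mu> j\<bar> * \<bar>p - w\<bar> ^ (2 * b - (k - j)) \<le> 1 * \<bar>p - w\<bar> ^ (2 * b - (k - j))"
        using \<mu> by (intro mult_right_mono) auto
      also have "1 * \<bar>p - w\<bar> ^ (2 * b - (k - j)) \<le> \<bar>p - w\<bar> ^ (2 * Suc b - k)"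
        unfolding mult_1 using pw j False by (intro power_decreasing) auto
      finally show ?thesis .
    qed
    then have "real b ^ (k - j) * (\<bar>\<mu> j\<bar> * \<bar>p - w\<bar> ^ (2 * b - (k - j))) \<le>
       real b ^ (k - j) * \<bar>p - w\<bar> ^ (2 * Suc b - k)"
      by (intro mult_left_mono) auto
    moreover have "\<bar>\<mu> j\<bar> * \<bar>(fdiff ^^ b) (bern_moment p w (k - j)) 0\<bar> \<le>
       \<bar>\<mu> j\<bar> * (real b ^ (k - j) * \<bar>p - w\<bar> ^ (2 * b - (k - j)))"
      by (intro mult_left_mono Suc.IH) auto
    ultimately show "\<bar>\<mu> j\<bar> * \<bar>(fdiff ^^ b) (bern_moment p w (k - j)) 0\<bar>
        \<le> real b ^ (k - j) * \<bar>p - w\<bar> ^ (2 * Suc b - k)"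
      by (simp add: mult.left_commute)
  qed auto
  also have "\<dots> = (\<Sum>j\<in>{1..k}. real (k choose j) * real b ^ (k - j)) * \<bar>p - w\<bar> ^ (2 * Suc b - k)"
    by (simp add: sum_distrib_right mult.assoc)
  \<comment> \<open>The added summand \<open>j = 0\<close> completes the binomial expansion of
    \<open>(1 + b) ^ k\<close>.\<close>
  also have "\<dots> \<le> (\<Sum>j\<le>k. real (k choose j) * real b ^ (k - j)) * \<bar>p - w\<bar> ^ (2 * Suc b - k)"
    by (intro mult_right_mono sum_mono2) auto
  also have "(\<Sum>j\<le>k. real (k choose j) * real b ^ (k - j)) = real (Suc b) ^ k"
    using binomial_ring[of 1 "real b" k] by simp
  finally show ?case .
qed

text \<open>Induction by \<open>(b + 1) (m choose (b + 1)) = (m - b) (m choose b)\<close>. What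
  matters is that the coefficients do not depend on \<open>m\<close>.\<close>

lemma binomial_eq_polynomial: "\<exists>c. \<forall>m. real (m choose b) = (\<Sum>l\<le>b. c l * real m ^ l)"
proof (induction b)
  case 0
  show ?case by (intro exI[of _ "\<lambda>_. 1"]) simp
next
  case (Suc b)
  then obtain c where c: "\<And>m. real (m choose b) = (\<Sum>l\<le>b. c l * real m ^ l)" by blast
  \<comment> \<open>Coefficients of \<open>(m - b) / (b + 1)\<close> times the polynomial for
    \<open>m choose b\<close>.\<close>
  define c' where "c' l = ((if l = 0 then 0 else c (l - 1)) - (if l \<le> b then real b * c l else 0)) / real (Suc b)"
    for l
  have "real (m choose Suc b) = (\<Sum>l\<le>Suc b. c' l * real m ^ l)" for m
  proof -
    have "(\<Sum>l\<le>Suc b. c' l * real m ^ l) * real (Suc b) =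
       (\<Sum>l\<le>Suc b. (if l = 0 then 0 else c (l - 1)) * real m ^ l) -
       (\<Sum>l\<le>Suc b. (if l \<le> b then real b * c l else 0) * real m ^ l)"
      unfolding sum_subtractf[symmetric] sum_distrib_right
      by (intro sum.cong refl) (simp add: c'_def field_simps)
    also have "(\<Sum>l\<le>Suc b. (if l = 0 then 0 else c (l - 1)) * real m ^ l) =
        real m * (\<Sum>l\<le>b. c l * real m ^ l)"
      by (simp add: sum.atMost_Suc_shift sum_distrib_left algebra_simps del: sum.atMost_Suc)
    also have "(\<Sum>l\<le>Suc b. (if l \<le> b then real b * c l else 0) * real m ^ l) =
        real b * (\<Sum>l\<le>b. c l * real m ^ l)"
      by (simp add: sum_distrib_left algebra_simps)
    finally have "(\<Sum>l\<le>Suc b. c' l * real m ^ l) * real (Suc b) =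
        (real m - real b) * real (m choose b)"
      by (simp add: c algebra_simps)
    also have "\<dots> = real (m choose Suc b) * real (Suc b)"
      using gbinomial_mult_1[of "real m" b] by (simp add: binomial_gbinomial algebra_simps)
    finally show ?thesis by simp
  qed
  then show ?case by blast
qed

text \<open>For \<open>w = p\<close> the bound on the \<open>b\<close>-th difference contains a
  positive power of zero once \<open>2 * b > k\<close>. Newton's series thus stops at
  \<open>k div 2\<close> for every \<open>m\<close>, and the moment is a polynomial in
  \<open>m\<close> of at most that degree.\<close>

lemma bern_moment_central_newton:
  assumes "p \<in> {0..1}"
  shows "bern_moment p p k m =
    (\<Sum>b\<le>k div 2. real (m choose b) * (fdiff ^^ b) (bern_moment p p k) 0)"
proof -
  have z: "(fdiff ^^ b) (bern_moment p p k) 0 = 0" if "\<not> b \<le> k div 2" for b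
  proof -
    have "2 * b - k > 0" using that by linarith
    then show ?thesis
      using abs_fdiff_bern_moment_le[OF assms assms, of b k] by (simp add: power_0_left)
  qed
  have "bern_moment p p k m = (\<Sum>b\<le>m. real (m choose b) * (fdiff ^^ b) (bern_moment p p k) 0)"
    using newton_forward[of "bern_moment p p k" 0 m] by simp
  \<comment> \<open>A common range for both truncations: the binomial coefficient vanishes for
    \<open>b > m\<close>, the difference for \<open>b > k div 2\<close>.\<close>
  also have "\<dots> = (\<Sum>b\<le>max m (k div 2). real (m choose b) * (fdiff ^^ b) (bern_moment p p k) 0)"
    by (intro sum.mono_neutral_left) auto
  also have "\<dots> = (\<Sum>b\<le>k div 2. real (m choose b) * (fdiff ^^ b) (bern_moment p p k) 0)"
    using z by (intro sum.mono_neutral_right) auto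
  finally show ?thesis .
qed

lemma abs_fdiff_bern_moment_le_const:
  assumes "p \<in> {0..1}" "w \<in> {0..1}" "b \<le> B"
  shows "\<bar>(fdiff ^^ b) (bern_moment p w k) 0\<bar> \<le> real B ^ k"
proof -
  have "\<bar>(fdiff ^^ b) (bern_moment p w k) 0\<bar> \<le> real b ^ k * \<bar>p - w\<bar> ^ (2 * b - k)"
    by (rule abs_fdiff_bern_moment_le) fact+
  also have "\<dots> \<le> real B ^ k * 1"
    using assms by (intro mult_mono power_mono power_le_one) auto
  finally show ?thesis by simp
qed

lemma abs_bern_moment_central_le:
  assumes "p \<in> {0..1}" "m \<ge> 1"
  shows "\<bar>bern_moment p p k m\<bar> \<le> real (Suc k) * (real m ^ (k div 2) * real k ^ k)"
proof -
  have "\<bar>bern_moment p p k m\<bar> \<le>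
      (\<Sum>b\<le>k div 2. \<bar>real (m choose b) * (fdiff ^^ b) (bern_moment p p k) 0\<bar>)"
    by (subst bern_moment_central_newton[OF assms(1)]) (rule sum_abs)
  also have "\<dots> \<le> (\<Sum>b\<le>k div 2. real m ^ (k div 2) * real k ^ k)"
  proof (intro sum_mono)
    fix b assume b: "b \<in> {..k div 2}"
    have "real (m choose b) \<le> real m ^ (k div 2)"
    proof (cases "b \<le> m")
      case True
      have "m choose b \<le> m ^ b" by (rule binomial_le_pow[OF True])
      also have "\<dots> \<le> m ^ (k div 2)"
        using b assms(2) by (intro power_increasing) simp_all
      finally show ?thesis unfolding of_nat_power[symmetric] of_nat_le_iff .
    qed (simp add: binomial_eq_0)
    moreover have "b \<le> k" using b by simp
    then have "\<bar>(fdiff ^^ b) (bern_moment p p k) 0\<bar> \<le> real k ^ k"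
      by (rule abs_fdiff_bern_moment_le_const[OF assms(1) assms(1)])
    ultimately show "\<bar>real (m choose b) * (fdiff ^^ b) (bern_moment p p k) 0\<bar> \<le> real m ^ (k div 2) * real k ^ k"
      unfolding abs_mult abs_of_nat by (rule mult_mono) simp_all
  qed
  also have "\<dots> = real (Suc (k div 2)) * (real m ^ (k div 2) * real k ^ k)"
    unfolding sum_constant card_atMost ..
  also have "\<dots> \<le> real (Suc k) * (real m ^ (k div 2) * real k ^ k)"
    by (rule mult_right_mono) simp_all
  finally show ?thesis .
qed

lemma bern_exp_deviation_power:
  assumes "m \<ge> 1"
  shows "bern_exp p m (\<lambda>j. (real j / real m - p) ^ k) = bern_moment p p k m / real m ^ k"
proof -
  have "bern_exp p m (\<lambda>j. (real j / real m - p) ^ k) =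
      bern_exp p m (\<lambda>j. (1 / real m ^ k) * (real j - real m * p) ^ k)"
  proof (rule bern_exp_cong)
    fix j
    have "real j / real m - p = (real j - real m * p) / real m"
      using assms by (simp add: field_simps)
    then show "(real j / real m - p) ^ k = (1 / real m ^ k) * (real j - real m * p) ^ k"
      by (simp add: power_divide)
  qed
  also have "\<dots> = bern_moment p p k m / real m ^ k"
    unfolding bern_exp_cmult bern_moment_def by simp
  finally show ?thesis .
qed

text \<open>To cover odd \<open>a\<close>, the absolute moment is reduced to the even one of order
  \<open>2 * a\<close> by \<open>2 y \<le> x y^2 + 1 / x\<close>, where
  \<open>x = N powr (a / 2)\<close> balances both terms.\<close>

lemma bern_exp_abs_deviation_le:
  "\<exists>K\<ge>0. \<forall>p\<in>{0..1}. \<forall>N\<ge>1. bern_exp p N (\<lambda>j. \<bar>real j / real N - p\<bar> ^ a) \<le> K * real N powr (- real a / 2)"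
proof -
  define C where "C = real (Suc (2 * a)) * real (2 * a) ^ (2 * a)"
  have "bern_exp p N (\<lambda>j. \<bar>real j / real N - p\<bar> ^ a) \<le> ((C + 1) / 2) * real N powr (- real a / 2)"
    if p: "p \<in> {0..1}" and N: "N \<ge> 1" for p N
  proof -
    let ?x = "real N powr (real a / 2)"
    have x: "?x > 0" using N by simp
    have xx: "?x * ?x = real N ^ a"
      using N by (simp add: powr_add[symmetric] powr_realpow)
    have "bern_exp p N (\<lambda>j. \<bar>real j / real N - p\<bar> ^ a) \<le>
       bern_exp p N (\<lambda>j. (?x / 2) * (real j / real N - p) ^ (2 * a) + inverse ?x / 2)"
    proof (rule bern_exp_mono[OF p])
      fix j
      define y where "y = \<bar>real j / real N - p\<bar> ^ a"
      have y: "(real j / real N - p) ^ (2 * a) = y * y"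
        by (simp add: y_def mult_2 power_add power_mult_distrib[symmetric])
      have "0 \<le> (?x * y - 1)\<^sup>2 / ?x" using x by simp
      also have "\<dots> = ?x * (y * y) - 2 * y + inverse ?x"
        using x by (simp add: power2_eq_square field_simps)
      finally show "\<bar>real j / real N - p\<bar> ^ a \<le> ?x / 2 * (real j / real N - p) ^ (2 * a) + inverse ?x / 2"
        unfolding y y_def[symmetric] by simp
    qed
    also have "\<dots> = (?x / 2) * bern_exp p N (\<lambda>j. (real j / real N - p) ^ (2 * a)) + inverse ?x / 2"
      unfolding bern_exp_add bern_exp_cmult by simp
    also have "bern_exp p N (\<lambda>j. (real j / real N - p) ^ (2 * a)) = bern_moment p p (2 * a) N / real N ^ (2 * a)"
      by (rule bern_exp_deviation_power[OF N])
    also have "\<dots> \<le> (C * real N ^ a) / real N ^ (2 * a)"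
      using abs_bern_moment_central_le[OF p N, of "2 * a"] unfolding C_def
      by (intro divide_right_mono) (simp_all add: mult_ac)
    also have "\<dots> = C / (?x * ?x)"
      using N unfolding xx by (simp add: mult_2 power_add)
    also have "?x / 2 * (C / (?x * ?x)) + inverse ?x / 2 = ((C + 1) / 2) * inverse ?x"
      using x by (simp add: field_simps)
    also have "inverse ?x = real N powr (- real a / 2)"
      by (simp add: powr_minus)
    finally show ?thesis using x by simp
  qed
  moreover have "(C + 1) / 2 \<ge> 0" by (simp add: C_def)
  ultimately show ?thesis by blast
qed

subsection \<open>The jackknife weights\<close>

text \<open>With \<open>N = n - q\<close> and \<open>t = i - 1\<close> this is the jackknife
  coefficient, written with the signed binomial coefficient of a \<open>q\<close>-th
  difference.\<close>

definition jk_weight :: "nat \<Rightarrow> nat \<Rightarrow> nat \<Rightarrow> real" where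
  "jk_weight q N t = (-1) ^ (q - t) * real (q choose t) * (real N + real t) ^ q / fact q"

lemma sum_jk_weight:
  "(\<Sum>t\<le>q. jk_weight q N t * g t) = (fdiff ^^ q) (\<lambda>x::nat. (real N + real x) ^ q * g x) 0 / fact q"
  by (simp add: fdiff_funpow_eq_sum jk_weight_def sum_divide_distrib algebra_simps)

text \<open>Passes from differences over the naturals to differences over the reals, to which the
  mean value form applies.\<close>

lemma fdiff_funpow_of_nat:
  "(fdiff ^^ a) (\<lambda>x::nat. h (c + real x)) y = (fdiff ^^ a) h (c + real y)"
  by (simp add: fdiff_funpow_eq_sum algebra_simps)

lemma power_divide_power_eq_powr:
  fixes x :: real
  assumes "x > 0"
  shows "x ^ q / x ^ d = x powr (real q - real d)"
  using assms by (simp add: powr_diff powr_realpow)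

text \<open>\<open>x ^ q / x ^ d\<close> is a real power with exponent \<open>q - d\<close>, and
  \<open>q\<close> differences lower it to \<open>- d\<close>. The product is \<open>q!\<close> for
  \<open>d = 0\<close> and zero for \<open>1 \<le> d \<le> q\<close>.\<close>

lemma sum_jk_weight_divide_power:
  assumes "N \<ge> 1"
  shows "\<exists>\<xi>\<ge>real N. (\<Sum>t\<le>q. jk_weight q N t / (real N + real t) ^ d) =
    (\<Prod>i<q. real q - real d - real i) / fact q * \<xi> powr (- real d)"
proof -
  have "(\<lambda>x::nat. (real N + real x) ^ q * (1 / (real N + real x) ^ d)) =
      (\<lambda>x. (real N + real x) powr (real q - real d))"
    using assms by (auto simp flip: power_divide_power_eq_powr)
  then have "(\<Sum>t\<le>q. jk_weight q N t * (1 / (real N + real t) ^ d)) =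
     (fdiff ^^ q) (\<lambda>y. y powr (real q - real d)) (real N) / fact q"
    unfolding sum_jk_weight using fdiff_funpow_of_nat[of q "\<lambda>y. y powr (real q - real d)" "real N" 0] by simp
  moreover obtain \<xi> where "\<xi> \<in> {real N..real N + real q}"
    "(fdiff ^^ q) (\<lambda>y. y powr (real q - real d)) (real N) =
     (\<Prod>i<q. real q - real d - real i) * \<xi> powr (real q - real d - real q)"
    using fdiff_powr_mean_value[of "real N" q "real q - real d"] assms by auto
  ultimately show ?thesis by (intro exI[of _ \<xi>]) simp
qed

lemma sum_jk_weight_eq_1:
  assumes "N \<ge> 1"
  shows "(\<Sum>t\<le>q. jk_weight q N t) = 1"
proof -
  have "(\<Prod>i<q. real q - real i) = fact q"
    by (simp add: fact_prod_rev of_nat_diff atLeast0LessThan)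
  moreover obtain \<xi> where "\<xi> \<ge> real N"
    "(\<Sum>t\<le>q. jk_weight q N t) = (\<Prod>i<q. real q - real i) / fact q * \<xi> powr 0"
    using sum_jk_weight_divide_power[OF assms, of q 0] by auto
  ultimately show ?thesis using assms by simp
qed

text \<open>For \<open>1 \<le> d \<le> q\<close> the sum vanishes, so only \<open>d > q\<close> contributes.\<close>

lemma abs_sum_jk_weight_divide_power_le:
  assumes "d \<ge> 1"
  shows "\<exists>K\<ge>0. \<forall>N\<ge>1. \<bar>\<Sum>t\<le>q. jk_weight q N t / (real N + real t) ^ d\<bar> \<le> K * real N powr (- real (Suc q))"
proof -
  let ?P = "(\<Prod>i<q. real q - real d - real i) / fact q :: real"
  have "\<bar>\<Sum>t\<le>q. jk_weight q N t / (real N + real t) ^ d\<bar> \<le> \<bar>?P\<bar> * real N powr (- real (Suc q))"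
    if N: "N \<ge> 1" for N
  proof -
    obtain \<xi> where \<xi>: "\<xi> \<ge> real N"
      "(\<Sum>t\<le>q. jk_weight q N t / (real N + real t) ^ d) = ?P * \<xi> powr (- real d)"
      using sum_jk_weight_divide_power[OF N] by blast
    show ?thesis
    proof (cases "d \<le> q")
      case True
      have z: "(\<Prod>i<q. real q - real d - real i) = 0"
        using True assms by (intro prod_zero bexI[of _ "q - d"]) (auto simp: of_nat_diff)
      show ?thesis unfolding \<xi>(2) z by simp
    next
      case False
      have "\<xi> powr (- real d) \<le> real N powr (- real d)"
        using \<xi> N by (intro powr_mono2') auto
      also have "\<dots> \<le> real N powr (- real (Suc q))"
        using False N by (intro powr_mono) auto
      finally show ?thesis
        unfolding \<xi>(2) abs_mult by (intro mult_left_mono) auto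
    qed
  qed
  then show ?thesis by (intro exI[of _ "\<bar>?P\<bar>"]) auto
qed

text \<open>The shift \<open>b\<close> comes from the Leibniz rule; since \<open>N \<ge> 1\<close>,
  the intermediate point stays within the factor \<open>1 + a + b\<close> of
  \<open>N\<close>.\<close>

lemma abs_fdiff_powr_le:
  "\<exists>K\<ge>0. \<forall>N\<ge>1. \<bar>(fdiff ^^ a) (\<lambda>y. y powr e) (real N + real b)\<bar> \<le> K * real N powr (e - real a)"
proof -
  let ?K = "\<bar>\<Prod>i<a. e - real i\<bar> * (1 + real a + real b) powr \<bar>e - real a\<bar>"
  have "\<bar>(fdiff ^^ a) (\<lambda>y. y powr e) (real N + real b)\<bar> \<le> ?K * real N powr (e - real a)"
    if N: "N \<ge> 1" for N :: nat
  proof -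
    obtain \<xi> where \<xi>: "\<xi> \<in> {real N + real b..real N + real b + real a}"
      "(fdiff ^^ a) (\<lambda>y. y powr e) (real N + real b) = (\<Prod>i<a. e - real i) * \<xi> powr (e - real a)"
      using fdiff_powr_mean_value[of "real N + real b" a e] N by auto
    have "real a \<le> real a * real N" "real b \<le> real b * real N"
      using N by (simp_all add: mult_le_cancel_left1)
    then have "\<xi> \<le> (1 + real a + real b) * real N"
      using \<xi>(1) by (simp add: algebra_simps)
    then have "\<xi> powr (e - real a) \<le> (1 + real a + real b) powr \<bar>e - real a\<bar> * real N powr (e - real a)"
      using \<xi>(1) N by (intro powr_le_comparable) auto
    then show ?thesis
      unfolding \<xi>(2) abs_mult mult.assoc by (intro mult_left_mono) auto
  qed
  then show ?thesis by (intro exI[of _ ?K]) auto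
qed

text \<open>Leibniz rule for the power \<open>x powr (q - k)\<close> at \<open>x = N + t\<close>
  times the moment: \<open>q - b\<close> differences of the power give
  \<open>N powr (b - k)\<close>, and \<open>b\<close> differences of the moment give
  \<open>\<bar>p - w\<bar> ^ (2 * b - k)\<close>.\<close>

lemma abs_sum_jk_weight_bern_moment_le:
  "\<exists>K\<ge>0. \<forall>N\<ge>1. \<forall>p\<in>{0..1}. \<forall>w\<in>{0..1}.
     \<bar>\<Sum>t\<le>q. jk_weight q N t / (real N + real t) ^ k * bern_moment p w k t\<bar> \<le>
     K * (\<Sum>b\<le>q. real N powr (real b - real k) * \<bar>p - w\<bar> ^ (2 * b - k))"
proof -
  let ?u = "\<lambda>y. y powr (real q - real k)"
  have "\<exists>K\<ge>0. \<forall>N\<ge>1. \<bar>(fdiff ^^ (q - b)) ?u (real N + real b)\<bar> \<le> K * real N powr (real q - real k - real (q - b))"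
    for b by (rule abs_fdiff_powr_le)
  then obtain K where K: "\<And>b. K b \<ge> 0"
    "\<And>b N. N \<ge> 1 \<Longrightarrow> \<bar>(fdiff ^^ (q - b)) ?u (real N + real b)\<bar> \<le> K b * real N powr (real q - real k - real (q - b))"
    by metis
  define C where "C = (\<Sum>b\<le>q. real (q choose b) * (K b * real q ^ k))"
  have C0: "C \<ge> 0" unfolding C_def using K(1) by (intro sum_nonneg) auto
  have "\<bar>\<Sum>t\<le>q. jk_weight q N t / (real N + real t) ^ k * bern_moment p w k t\<bar> \<le>
     C * (\<Sum>b\<le>q. real N powr (real b - real k) * \<bar>p - w\<bar> ^ (2 * b - k))"
    if N: "N \<ge> 1" and p: "p \<in> {0..1}" and w: "w \<in> {0..1}" for N p w
  proof -
    let ?S = "\<Sum>b\<le>q. real N powr (real b - real k) * \<bar>p - w\<bar> ^ (2 * b - k)"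
    have e: "(real N + real x) ^ q * (bern_moment p w k x / (real N + real x) ^ k) =
        ?u (real N + real x) * bern_moment p w k x" for x
      using N by (subst power_divide_power_eq_powr[symmetric]) auto
    have "(\<Sum>t\<le>q. jk_weight q N t / (real N + real t) ^ k * bern_moment p w k t) =
       (\<Sum>t\<le>q. jk_weight q N t * (bern_moment p w k t / (real N + real t) ^ k))"
      by simp
    also have "\<dots> = (fdiff ^^ q) (\<lambda>x. ?u (real N + real x) * bern_moment p w k x) 0 / fact q"
      unfolding sum_jk_weight e ..
    also have "\<dots> = (\<Sum>b\<le>q. real (q choose b) *
        ((fdiff ^^ (q - b)) ?u (real N + real b) * (fdiff ^^ b) (bern_moment p w k) 0)) / fact q"
      unfolding fdiff_funpow_mult fdiff_funpow_of_nat[of _ ?u] by simp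
    finally have "\<bar>\<Sum>t\<le>q. jk_weight q N t / (real N + real t) ^ k * bern_moment p w k t\<bar> =
       \<bar>\<Sum>b\<le>q. real (q choose b) *
        ((fdiff ^^ (q - b)) ?u (real N + real b) * (fdiff ^^ b) (bern_moment p w k) 0)\<bar> / fact q"
      by simp
    also have "\<dots> \<le> \<bar>\<Sum>b\<le>q. real (q choose b) *
        ((fdiff ^^ (q - b)) ?u (real N + real b) * (fdiff ^^ b) (bern_moment p w k) 0)\<bar> / 1"
      by (intro divide_left_mono) auto
    also have "\<dots> \<le> (\<Sum>b\<le>q. real (q choose b) *
        (\<bar>(fdiff ^^ (q - b)) ?u (real N + real b)\<bar> * \<bar>(fdiff ^^ b) (bern_moment p w k) 0\<bar>))"
      by (auto intro!: order_trans[OF sum_abs] simp: abs_mult)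
    also have "\<dots> \<le> (\<Sum>b\<le>q. real (q choose b) * (K b * real q ^ k) * ?S)"
    proof (intro sum_mono)
      fix b assume b: "b \<in> {..q}"
      have "\<bar>(fdiff ^^ (q - b)) ?u (real N + real b)\<bar> * \<bar>(fdiff ^^ b) (bern_moment p w k) 0\<bar>
          \<le> (K b * real N powr (real q - real k - real (q - b))) * (real b ^ k * \<bar>p - w\<bar> ^ (2 * b - k))"
        using K(1) by (intro mult_mono K(2) N abs_fdiff_bern_moment_le p w) auto
      also have "real q - real k - real (q - b) = real b - real k"
        using b by (simp add: of_nat_diff)
      also have "(K b * real N powr (real b - real k)) * (real b ^ k * \<bar>p - w\<bar> ^ (2 * b - k)) =
         (K b * real b ^ k) * (real N powr (real b - real k) * \<bar>p - w\<bar> ^ (2 * b - k))"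
        by simp
      \<comment> \<open>One summand is enlarged to the whole of \<open>?S\<close>, so that the
        constants can be summed apart from \<open>N\<close>, \<open>p\<close> and
        \<open>w\<close>.\<close>
      also have "\<dots> \<le> (K b * real q ^ k) * ?S"
        using b K(1)[of b]
        by (intro mult_mono mult_left_mono power_mono member_le_sum) (auto intro!: sum_nonneg)
      finally show "real (q choose b) *
        (\<bar>(fdiff ^^ (q - b)) ?u (real N + real b)\<bar> * \<bar>(fdiff ^^ b) (bern_moment p w k) 0\<bar>)
         \<le> real (q choose b) * (K b * real q ^ k) * ?S"
        unfolding mult.assoc by (intro mult_left_mono) auto
    qed
    also have "\<dots> = C * ?S"
      by (simp add: C_def sum_distrib_right)
    finally show ?thesis .
  qed
  then show ?thesis using C0 by blast
qed

section \<open>The estimator as a weighted sum of binomial means\<close>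

text \<open>The sizes differ by \<open>t - j\<close>. Indices \<open>j < t\<close> multiply to
  \<open>t!\<close> and indices \<open>j > t\<close> to \<open>(-1) ^ (q - t) * (q - t)!\<close>;
  the reciprocal is the signed binomial coefficient over \<open>q!\<close>.\<close>

lemma jk_coeff_eq_jk_weight:
  assumes "n \<ge> Suc q" "t \<le> q"
  shows "jk_coeff (Suc q) n (Suc t) = jk_weight q (n - q) t"
proof -
  have sz: "jk_size (Suc q) n (Suc j) = n - q + j" for j
    using assms by (simp add: jk_size_def)
  have "{1..Suc q} - {Suc t} = Suc ` ({..q} - {t})"
    by (simp add: image_set_diff[OF inj_Suc] image_Suc_atMost)
  then have "jk_coeff (Suc q) n (Suc t) =
      (\<Prod>j\<in>{..q} - {t}. (real (n - q) + real t) / (real t - real j))"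
    unfolding jk_coeff_def by (simp add: prod.reindex sz)
  also have "\<dots> = (real (n - q) + real t) ^ q / (\<Prod>j\<in>{..q} - {t}. real t - real j)"
    using assms by (simp add: prod_dividef)
  also have "{..q} - {t} = {..<t} \<union> {t<..q}"
    using assms by auto
  also have "(\<Prod>j\<in>{..<t} \<union> {t<..q}. real t - real j) =
      (\<Prod>j<t. real t - real j) * (\<Prod>j\<in>{t<..q}. real t - real j)"
    by (intro prod.union_disjoint) auto
  also have "(\<Prod>j<t. real t - real j) = fact t"
    by (simp add: fact_prod_rev of_nat_diff atLeast0LessThan)
  also have "(\<Prod>j\<in>{t<..q}. real t - real j) = (\<Prod>i\<in>{1..q - t}. - real i)"
    using assms by (intro prod.reindex_bij_witness[of _ "\<lambda>i. t + i" "\<lambda>j. j - t"]) (auto simp: of_nat_diff)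
  also have "\<dots> = (-1) ^ (q - t) * fact (q - t)"
    by (simp add: prod_uminus fact_prod)
  finally show ?thesis
    using assms by (cases "even (q - t)") (simp_all add: jk_weight_def binomial_fact)
qed

text \<open>Every subset of size \<open>m\<close> has the same expectation, that of a binomial
  variable with \<open>m\<close> trials, so the average over subsets disappears.\<close>

lemma jackknife_mean_eq_bern_exp:
  assumes n: "n \<ge> Suc q" and p: "p \<in> {0..1}"
  shows "jackknife_mean (Suc q) n f p =
    (\<Sum>t\<le>q. jk_weight q (n - q) t *
       bern_exp p (n - q + t) (\<lambda>j. f (real j / (real (n - q) + real t))))"
proof -
  let ?M = "bernoulli_samples n p"
  have fin: "finite (set_pmf ?M)"
    unfolding bernoulli_samples_def by (simp add: set_Pi_pmf finite_PiE_dflt)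
  have int: "integrable (measure_pmf ?M) h" for h :: "(nat \<Rightarrow> bool) \<Rightarrow> real"
    by (rule integrable_measure_pmf_finite[OF fin])
  \<comment> \<open>Samples outside \<open>S\<close> are integrated out: the marginal of the product
    distribution on \<open>S\<close> is again a product.\<close>
  have S: "measure_pmf.expectation ?M (\<lambda>X. f ((\<Sum>k\<in>S. of_bool (X k)) / real m)) =
      bern_exp p m (\<lambda>j. f (real j / real m))"
    if "S \<subseteq> {1..n}" "card S = m" for S m
  proof -
    have fS: "finite S" using that finite_subset by blast
    have "binomial_pmf m p = map_pmf (\<lambda>X. card {x\<in>S. X x}) (Pi_pmf S False (\<lambda>_. bernoulli_pmf p))"
      by (rule binomial_pmf_altdef'[OF fS that(2) p])
    also have "\<dots> = map_pmf (\<lambda>X. card {x\<in>S. X x}) ?M"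
      unfolding bernoulli_samples_def Pi_pmf_subset[OF finite_atLeastAtMost that(1)]
      by (auto simp: map_pmf_comp intro!: map_pmf_cong arg_cong[of _ _ card])
    finally have "bern_exp p m (\<lambda>j. f (real j / real m)) =
        measure_pmf.expectation ?M (\<lambda>X. f (real (card {x\<in>S. X x}) / real m))"
      unfolding expectation_binomial_pmf_eq_bern_exp[OF p, symmetric] by simp
    moreover have "real (card {x\<in>S. X x}) = (\<Sum>k\<in>S. of_bool (X k))" for X
      using fS by (simp add: Int_def)
    ultimately show ?thesis by simp
  qed
  have avg: "measure_pmf.expectation ?M (\<lambda>X. subsample_average n m f (\<lambda>k. of_bool (X k))) =
      bern_exp p m (\<lambda>j. f (real j / real m))" if "m \<le> n" for m
  proof -
    let ?A = "{S. S \<subseteq> {1..n} \<and> card S = m}"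
    have "card ?A = n choose m"
      using n_subsets[of "{1..n}" m] by simp
    then have "card ?A \<noteq> 0" using that by simp
    moreover have "measure_pmf.expectation ?M (\<lambda>X. \<Sum>S\<in>?A. f ((\<Sum>k\<in>S. of_bool (X k)) / real m)) =
       (\<Sum>S\<in>?A. bern_exp p m (\<lambda>j. f (real j / real m)))"
      unfolding Bochner_Integration.integral_sum[OF int]
      by (rule sum.cong[OF refl]) (rule S, auto)
    ultimately show ?thesis
      unfolding subsample_average_def by simp
  qed
  have "jackknife_mean (Suc q) n f p = (\<Sum>i=1..Suc q. jk_coeff (Suc q) n i *
      measure_pmf.expectation ?M (\<lambda>X. subsample_average n (jk_size (Suc q) n i) f (\<lambda>k. of_bool (X k))))"
    unfolding jackknife_mean_def jackknife_def using int
    by (subst Bochner_Integration.integral_sum) auto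
  also have "\<dots> = (\<Sum>t\<le>q. jk_coeff (Suc q) n (Suc t) *
      measure_pmf.expectation ?M (\<lambda>X. subsample_average n (jk_size (Suc q) n (Suc t)) f (\<lambda>k. of_bool (X k))))"
    by (simp only: One_nat_def sum.shift_bounds_cl_Suc_ivl atLeast0AtMost)
  also have "\<dots> = (\<Sum>t\<le>q. jk_weight q (n - q) t *
       bern_exp p (n - q + t) (\<lambda>j. f (real j / (real (n - q) + real t))))"
  proof (intro sum.cong refl)
    fix t assume t: "t \<in> {..q}"
    have sz: "jk_size (Suc q) n (Suc t) = n - q + t"
      using n by (simp add: jk_size_def)
    have "measure_pmf.expectation ?M (\<lambda>X. subsample_average n (n - q + t) f (\<lambda>k. of_bool (X k))) =
        bern_exp p (n - q + t) (\<lambda>j. f (real j / real (n - q + t)))"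
      using t n by (intro avg) auto
    then show "jk_coeff (Suc q) n (Suc t) *
      measure_pmf.expectation ?M (\<lambda>X. subsample_average n (jk_size (Suc q) n (Suc t)) f (\<lambda>k. of_bool (X k)))
      = jk_weight q (n - q) t * bern_exp p (n - q + t) (\<lambda>j. f (real j / (real (n - q) + real t)))"
      unfolding sz of_nat_add using t n by (simp only: jk_coeff_eq_jk_weight atMost_iff)
  qed
  finally show ?thesis .
qed

subsection \<open>Taylor expansion under the smoothness condition\<close>

lemma deriv01_Suc: "deriv01 (Suc i) f x = vector_derivative (deriv01 i f) (at x within {0..1})"
  by (simp add: deriv01_def)

text \<open>Cousin's lemma yields a tagged division whose intervals tagged outside the exceptional null set
  grow at rate at most \<open>L + \<epsilon>\<close>, while those tagged inside it have small total length.\<close>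

lemma abs_continuous_on_interval_imp_lipschitz:
  fixes g :: "real \<Rightarrow> real"
  assumes ac: "abs_continuous_on_interval a b g"
    and ae: "AE x in lebesgue_on {a..b}.
      g differentiable (at x within {a..b}) \<and> \<bar>vector_derivative g (at x within {a..b})\<bar> \<le> L"
    and L: "L \<ge> 0" and xy: "a \<le> x" "x \<le> y" "y \<le> b"
  shows "\<bar>g y - g x\<bar> \<le> L * (y - x)"
proof -
  let ?P = "\<lambda>z. g differentiable (at z within {a..b}) \<and> \<bar>vector_derivative g (at z within {a..b})\<bar> \<le> L"
  have "AE z in lebesgue. z \<in> {a..b} \<longrightarrow> ?P z"
    using ae by (subst (asm) AE_restrict_space_iff) auto
  then obtain N where N: "\<And>z. z \<in> {a..b} \<Longrightarrow> z \<notin> N \<Longrightarrow> ?P z" and N0: "N \<in> null_sets lebesgue"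
    by (auto simp: eventually_ae_filter)
  \<comment> \<open>The part \<open>\<epsilon> * (y - x)\<close> is the slack in the difference
    quotients; the other \<epsilon> bounds the variation over intervals tagged in
    \<open>N\<close>.\<close>
  have "\<bar>g y - g x\<bar> \<le> L * (y - x) + \<epsilon> * (1 + (y - x))" if \<epsilon>: "\<epsilon> > 0" for \<epsilon>
  proof -
    obtain \<delta> where \<delta>: "\<delta> > 0" and ac\<delta>: "\<And>I :: (real \<times> real) set. finite I \<Longrightarrow>
        (\<forall>(u, v)\<in>I. a \<le> u \<and> u \<le> v \<and> v \<le> b) \<Longrightarrow>
        pairwise (\<lambda>(u, v) (u', v'). {u<..<v} \<inter> {u'<..<v'} = {}) I \<Longrightarrow>
        (\<Sum>(u, v)\<in>I. v - u) < \<delta> \<Longrightarrow> (\<Sum>(u, v)\<in>I. \<bar>g v - g u\<bar>) < \<epsilon>"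
      using ac \<epsilon> unfolding abs_continuous_on_interval_def by meson
    have Nm: "N \<in> lmeasurable" "N \<in> sets lebesgue"
      using N0 by (auto intro: fmeasurableI_null_sets)
    \<comment> \<open>Outer regularity: \<open>U\<close> covers the null set with measure below
      \<delta>, the total length that absolute continuity tolerates for \<epsilon>.\<close>
    obtain U where U: "open U" "N \<subseteq> U" "U - N \<in> lmeasurable" "emeasure lebesgue (U - N) < ennreal \<delta>"
      using sets_lebesgue_outer_open[OF Nm(2) \<delta>] .
    have Um: "U \<in> lmeasurable"
      using fmeasurable_Diff_D[OF U(3) Nm(1) U(2)] .
    have "emeasure lebesgue U < ennreal \<delta>"
      using U(4) Um N0 by (simp add: emeasure_Diff_null_set fmeasurableD)
    then have U\<delta>: "measure lebesgue U < \<delta>"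
      using Um \<delta> by (simp add: emeasure_eq_measure2 ennreal_less_iff)
    have "\<exists>d>0. \<forall>v\<in>{a..b}. \<bar>v - z\<bar> < d \<longrightarrow> \<bar>g v - g z\<bar> \<le> (L + \<epsilon>) * \<bar>v - z\<bar>"
      if z: "z \<in> {a..b}" "z \<notin> N" for z
    proof -
      define D where "D = vector_derivative g (at z within {a..b})"
      have "(g has_vector_derivative D) (at z within {a..b})" and D: "\<bar>D\<bar> \<le> L"
        using N[OF z] by (auto simp: D_def vector_derivative_works)
      then obtain d where "d > 0" and
        d: "\<And>v. v \<in> {a..b} \<Longrightarrow> \<bar>v - z\<bar> < d \<Longrightarrow> \<bar>g v - g z - (v - z) * D\<bar> \<le> \<epsilon> * \<bar>v - z\<bar>"
        using \<epsilon> unfolding has_vector_derivative_def has_derivative_within_alt by force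
      moreover have "\<bar>g v - g z\<bar> \<le> (L + \<epsilon>) * \<bar>v - z\<bar>" if "v \<in> {a..b}" "\<bar>v - z\<bar> < d" for v
      proof -
        have "\<bar>(v - z) * D\<bar> \<le> \<bar>v - z\<bar> * L"
          unfolding abs_mult using D by (intro mult_left_mono) auto
        then show ?thesis using d[OF that] by (simp add: algebra_simps)
      qed
      ultimately show ?thesis by blast
    qed
    then obtain d where d: "\<And>z. z \<in> {a..b} \<Longrightarrow> z \<notin> N \<Longrightarrow> d z > 0"
      "\<And>z v. z \<in> {a..b} \<Longrightarrow> z \<notin> N \<Longrightarrow> v \<in> {a..b} \<Longrightarrow> \<bar>v - z\<bar> < d z \<Longrightarrow> \<bar>g v - g z\<bar> \<le> (L + \<epsilon>) * \<bar>v - z\<bar>"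
      by metis
    \<comment> \<open>Fineness keeps intervals tagged in \<open>N\<close> inside \<open>U\<close>
      and all others where the difference quotient bound at the tag holds. \<open>UNIV\<close>
      completes the gauge outside \<open>{a..b}\<close>.\<close>
    define \<gamma> where "\<gamma> z = (if z \<in> N then U else if z \<in> {a..b} then ball z (d z) else UNIV)" for z
    have "gauge \<gamma>"
      using U(1,2) d(1) by (intro gaugeI) (auto simp: \<gamma>_def)
    then obtain T where T: "T tagged_division_of {x..y}" and fine: "\<gamma> fine T"
      by (rule fine_division_exists_real)
    note TD = tagged_division_ofD[OF T]
    have K: "\<exists>u v. K = {u..v} \<and> u \<le> z \<and> z \<le> v \<and> x \<le> u \<and> v \<le> y" if "(z, K) \<in> T" for z K
      using TD(2,3,4)[OF that] by fastforce
    \<comment> \<open>The value 0 on the empty set avoids unspecified \<open>Sup\<close> and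
      \<open>Inf\<close>, and makes \<phi> vanish on every degenerate box.\<close>
    define \<phi> where "\<phi> K = (if K = {} then 0 else \<bar>g (Sup K) - g (Inf K)\<bar>)" for K :: "real set"
    have \<phi>: "\<phi> {u..v} = \<bar>g v - g u\<bar>" if "u \<le> v" for u v
      using that by (simp add: \<phi>_def)
    define B where "B = {(z, K) \<in> T. z \<in> N}"
    have BT: "B \<subseteq> T" by (auto simp: B_def)
    have finB: "finite B" using BT TD(1) finite_subset by blast
    have "g y - g x = (\<Sum>(z, K)\<in>T. g (Sup K) - g (Inf K))"
      using additive_tagged_division_1[OF xy(2) T, of g] by simp
    also have "\<bar>\<dots>\<bar> \<le> (\<Sum>(z, K)\<in>T. \<phi> K)"
      using TD(2) by (intro order_trans[OF sum_abs] sum_mono) (fastforce simp: \<phi>_def)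
    also have "\<dots> = (\<Sum>(z, K)\<in>T - B. \<phi> K) + (\<Sum>(z, K)\<in>B. \<phi> K)"
      by (rule sum.subset_diff[OF BT TD(1)])
    also have "(\<Sum>(z, K)\<in>T - B. \<phi> K) \<le> (\<Sum>(z, K)\<in>T - B. (L + \<epsilon>) * measure lborel K)"
    proof (intro sum_mono, clarify)
      fix z K assume zK: "(z, K) \<in> T" "(z, K) \<notin> B"
      obtain u v where uv: "K = {u..v}" "u \<le> z" "z \<le> v" "x \<le> u" "v \<le> y"
        using K[OF zK(1)] by blast
      have z: "z \<in> {a..b}" "z \<notin> N" using zK uv xy by (auto simp: B_def)
      have "K \<subseteq> ball z (d z)"
        using fineD[OF fine zK(1)] z by (simp add: \<gamma>_def)
      moreover have "u \<in> K" "v \<in> K" using uv by auto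
      ultimately have "u \<in> ball z (d z)" "v \<in> ball z (d z)" by blast+
      then have "\<bar>u - z\<bar> < d z" "\<bar>v - z\<bar> < d z"
        by (auto simp: dist_real_def)
      \<comment> \<open>The tag lies between the endpoints, so the two bounds add up to the length
        of \<open>K\<close>.\<close>
      then have "\<bar>g u - g z\<bar> \<le> (L + \<epsilon>) * \<bar>u - z\<bar>" "\<bar>g v - g z\<bar> \<le> (L + \<epsilon>) * \<bar>v - z\<bar>"
        using z uv xy by (intro d(2); simp)+
      then show "\<phi> K \<le> (L + \<epsilon>) * measure lborel K"
        using uv by (simp add: \<phi> algebra_simps)
    qed
    also have "(\<Sum>(z, K)\<in>T - B. (L + \<epsilon>) * measure lborel K) \<le> (\<Sum>(z, K)\<in>T. (L + \<epsilon>) * measure lborel K)"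
      using TD(1) L \<epsilon> by (intro sum_mono2) auto
    also have "(\<Sum>(z, K)\<in>T. (L + \<epsilon>) * measure lborel K) = (L + \<epsilon>) * (y - x)"
    proof -
      have "(\<Sum>(z, K)\<in>T. measure lborel K) = y - x"
        using additive_content_tagged_division[of T x y] T xy by simp
      then show ?thesis by (simp add: case_prod_unfold flip: sum_distrib_left)
    qed
    also have "(\<Sum>(z, K)\<in>B. \<phi> K) \<le> \<epsilon>"
    proof -
      have "B tagged_partial_division_of {x..y}"
        using T BT tagged_partial_division_subset unfolding tagged_division_of_def by blast
      then have Btag: "B tagged_division_of \<Union>(snd ` B)"
        by (rule tagged_partial_division_of_Union_self)
      then have div: "(snd ` B) division_of \<Union>(snd ` B)"
        by (rule division_of_tagged_division)
      note DD = division_ofD[OF div]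
      have K': "Inf K \<le> Sup K" "K = {Inf K..Sup K}" "x \<le> Inf K" "Sup K \<le> y" if KB: "K \<in> snd ` B" for K
      proof -
        obtain z where "(z, K) \<in> T" using KB BT by auto
        from K[OF this] obtain u v where "K = {u..v}" "u \<le> v" "x \<le> u" "v \<le> y" by auto
        then show "Inf K \<le> Sup K" "K = {Inf K..Sup K}" "x \<le> Inf K" "Sup K \<le> y" by simp_all
      qed
      let ?\<iota> = "\<lambda>K :: real set. (Inf K, Sup K)"
      have inj: "inj_on ?\<iota> (snd ` B)"
      proof (rule inj_onI)
        fix K1 K2 assume "K1 \<in> snd ` B" "K2 \<in> snd ` B" "?\<iota> K1 = ?\<iota> K2"
        then show "K1 = K2" using K'(2)[of K1] K'(2)[of K2] by simp
      qed
      \<comment> \<open>Absolute continuity speaks of a set of intervals, so the tags are dropped;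
        an interval with two tags is degenerate and contributes zero.\<close>
      have "(\<Sum>(z, K)\<in>B. \<phi> K) = (\<Sum>K\<in>snd ` B. \<phi> K)"
      proof (rule sum.over_tagged_division_lemma[OF Btag])
        fix u v :: real assume "box u v = {}"
        then show "\<phi> (cbox u v) = 0"
          by (cases "u < v"; cases "u = v") (auto simp: \<phi>_def)
      qed
      also have "\<dots> = (\<Sum>K\<in>snd ` B. case ?\<iota> K of (u, v) \<Rightarrow> \<bar>g v - g u\<bar>)"
      proof (intro sum.cong refl)
        fix K assume "K \<in> snd ` B"
        then have "K \<noteq> {}" using DD(3) by blast
        then show "\<phi> K = (case ?\<iota> K of (u, v) \<Rightarrow> \<bar>g v - g u\<bar>)" by (simp add: \<phi>_def)
      qed
      also have "\<dots> = (\<Sum>(u, v)\<in>?\<iota> ` (snd ` B). \<bar>g v - g u\<bar>)"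
        by (simp only: sum.reindex[OF inj] o_def)
      also have "\<dots> < \<epsilon>"
      proof (rule ac\<delta>)
        show "finite (?\<iota> ` snd ` B)" using finB by blast
        show "\<forall>(u, v)\<in>?\<iota> ` snd ` B. a \<le> u \<and> u \<le> v \<and> v \<le> b"
        proof (rule ballI)
          fix e assume "e \<in> ?\<iota> ` snd ` B"
          then obtain K where "K \<in> snd ` B" "e = ?\<iota> K" by (rule imageE)
          with K'(1,3,4)[of K] xy show "case e of (u, v) \<Rightarrow> a \<le> u \<and> u \<le> v \<and> v \<le> b" by simp
        qed
        show "pairwise (\<lambda>(u, v) (u', v'). {u<..<v} \<inter> {u'<..<v'} = {}) (?\<iota> ` snd ` B)"
        proof (rule pairwiseI)
          fix i j assume "i \<in> ?\<iota> ` snd ` B" "j \<in> ?\<iota> ` snd ` B" "i \<noteq> j"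
          then obtain K1 K2 where KK: "K1 \<in> snd ` B" "K2 \<in> snd ` B" "i = ?\<iota> K1" "j = ?\<iota> K2" "K1 \<noteq> K2"
            by (metis (no_types, lifting) imageE)
          have "interior K1 \<inter> interior K2 = {}"
            using DD(5) KK by blast
          then show "(case i of (u, v) \<Rightarrow> \<lambda>(u', v'). {u<..<v} \<inter> {u'<..<v'} = {}) j"
            using arg_cong[OF K'(2)[OF KK(1)], of interior] arg_cong[OF K'(2)[OF KK(2)], of interior] KK(3,4)
            by simp
        qed
        have "(\<Sum>(u, v)\<in>?\<iota> ` snd ` B. v - u) = (\<Sum>K\<in>snd ` B. Sup K - Inf K)"
          by (subst sum.reindex[OF inj]) simp
        also have "\<dots> = (\<Sum>K\<in>snd ` B. measure lebesgue K)"
        proof (intro sum.cong refl)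
          fix K assume "K \<in> snd ` B"
          note K = K'(1,2)[OF this]
          have "Sup K - Inf K = measure lebesgue {Inf K..Sup K}"
            using K(1) by simp
          then show "Sup K - Inf K = measure lebesgue K"
            unfolding K(2)[symmetric] .
        qed
        also have "\<dots> = measure lebesgue (\<Union>(snd ` B))"
          by (rule content_division[OF div])
        also have "\<dots> \<le> measure lebesgue U"
        proof (rule measure_mono_fmeasurable)
          show "\<Union>(snd ` B) \<subseteq> U"
            using fineD[OF fine] by (fastforce simp: B_def \<gamma>_def)
          show "\<Union>(snd ` B) \<in> sets lebesgue"
            using lmeasurable_division[OF div] by (rule fmeasurableD)
        qed (rule Um)
        also have "\<dots> < \<delta>" by (rule U\<delta>)
        finally show "(\<Sum>(u, v)\<in>?\<iota> ` snd ` B. v - u) < \<delta>" .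
      qed
      finally show ?thesis by simp
    qed
    finally show ?thesis by (simp add: algebra_simps)
  qed
  note bound = this
  show ?thesis
  proof (rule field_le_epsilon)
    fix e :: real assume "e > 0"
    then have "e / (1 + (y - x)) > 0" using xy by simp
    from bound[OF this] show "\<bar>g y - g x\<bar> \<le> L * (y - x) + e"
      using xy by simp
  qed
qed

section \<open>Taylor bounds with a Lipschitz top derivative\<close>

text \<open>The remainder of \<open>h 0\<close> vanishes at \<open>x\<close>, and its derivative is
  the remainder of \<open>h 1\<close> of one order less; the mean value inequality on the segment
  gives the induction step. The constant \<open>L\<close> is kept throughout instead of being
  divided by factorials.\<close>

lemma taylor_lipschitz:
  fixes h :: "nat \<Rightarrow> real \<Rightarrow> real"
  assumes "\<And>i x. i < d \<Longrightarrow> x \<in> S \<Longrightarrow> (h i has_real_derivative h (Suc i) x) (at x within S)"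
    and "\<And>x y. x \<in> S \<Longrightarrow> y \<in> S \<Longrightarrow> \<bar>h d y - h d x\<bar> \<le> L * \<bar>y - x\<bar>"
    and "convex S" "L \<ge> 0" "x \<in> S" "y \<in> S"
  shows "\<bar>h 0 y - (\<Sum>l\<le>d. h l x * (y - x) ^ l / fact l)\<bar> \<le> L * \<bar>y - x\<bar> ^ Suc d"
  using assms
proof (induction d arbitrary: h y)
  case 0
  then show ?case by simp
next
  case (Suc d)
  define \<phi> where "\<phi> z = h 0 z - (h 0 x + (\<Sum>l\<le>d. h (Suc l) x * (z - x) ^ Suc l / fact (Suc l)))" for z
  define \<phi>' where "\<phi>' z = h 1 z - (\<Sum>l\<le>d. h (Suc l) x * (z - x) ^ l / fact l)" for z
  have sub: "closed_segment x y \<subseteq> S"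
    using Suc.prems(3,5,6) by (simp add: closed_segment_subset)
  have "norm (\<phi> y - \<phi> x) \<le> (L * \<bar>y - x\<bar> ^ Suc d) * norm (y - x)"
  proof (rule field_differentiable_bound[where S = "closed_segment x y" and f' = \<phi>'])
    fix z assume z: "z \<in> closed_segment x y"
    have "(h 0 has_real_derivative h 1 z) (at z within S)"
      using Suc.prems(1)[of 0 z] z sub by auto
    then have "(h 0 has_real_derivative h 1 z) (at z within closed_segment x y)"
      by (rule has_field_derivative_subset) (rule sub)
    moreover have "((\<lambda>z. h (Suc l) x * (z - x) ^ Suc l / fact (Suc l)) has_real_derivative
        h (Suc l) x * (z - x) ^ l / fact l) (at z within closed_segment x y)" for l
      by (rule derivative_eq_intros refl | simp add: field_simps del: of_nat_Suc)+
    ultimately have "(\<phi> has_real_derivative h 1 z - (0 + (\<Sum>l\<le>d. h (Suc l) x * (z - x) ^ l / fact l)))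
       (at z within closed_segment x y)"
      unfolding \<phi>_def by (intro DERIV_diff DERIV_add DERIV_const DERIV_sum)
    then show "(\<phi> has_real_derivative \<phi>' z) (at z within closed_segment x y)"
      by (simp add: \<phi>'_def)
    have "\<bar>\<phi>' z\<bar> \<le> L * \<bar>z - x\<bar> ^ Suc d"
      using Suc.IH[of "\<lambda>i. h (Suc i)" z] Suc.prems z sub by (auto simp: \<phi>'_def)
    also have "\<dots> \<le> L * \<bar>y - x\<bar> ^ Suc d"
      using Suc.prems(4) z by (intro mult_left_mono power_mono) (auto simp: closed_segment_eq_real_ivl split: if_splits)
    finally show "norm (\<phi>' z) \<le> L * \<bar>y - x\<bar> ^ Suc d" by simp
  qed auto
  moreover have "\<phi> x = 0" by (simp add: \<phi>_def)
  moreover have "\<phi> y = h 0 y - (\<Sum>l\<le>Suc d. h l x * (y - x) ^ l / fact l)"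
    unfolding \<phi>_def by (simp add: sum.atMost_Suc_shift del: sum.atMost_Suc fact_Suc power_Suc)
  ultimately show ?case by (simp add: mult_ac)
qed

text \<open>The almost everywhere bound makes the derivative of order \<open>s - 1\<close>
  Lipschitz. All \<open>k < s\<close> are covered because the remainder at \<open>p\<close> is
  re-expanded around a second point.\<close>

lemma condition_D_imp_taylor:
  assumes D: "condition_D s L f" and "L > 0" and "k < s" and x: "x \<in> {0..1}" and y: "y \<in> {0..1}"
  shows "\<bar>deriv01 k f y - (\<Sum>l<s - k. deriv01 (k + l) f x * (y - x) ^ l / fact l)\<bar> \<le> L * \<bar>y - x\<bar> ^ (s - k)"
proof -
  have s: "s \<noteq> 0" using \<open>k < s\<close> by simp
  note D' = D[unfolded condition_D_def, simplified s if_False]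
  have ae: "AE x in lebesgue_on {0..1}. deriv01 (s - 1) f differentiable (at x within {0..1}) \<and>
       \<bar>vector_derivative (deriv01 (s - 1) f) (at x within {0..1})\<bar> \<le> L"
    using D' s deriv01_Suc[of "s - 1" f] by simp
  have lip1: "\<bar>deriv01 (s - 1) f v - deriv01 (s - 1) f u\<bar> \<le> L * \<bar>v - u\<bar>"
    if "u \<in> {0..1}" "v \<in> {0..1}" "u \<le> v" for u v
    using abs_continuous_on_interval_imp_lipschitz[OF _ ae, of u v] D' that \<open>L > 0\<close> by simp
  have lip: "\<bar>deriv01 (s - 1) f v - deriv01 (s - 1) f u\<bar> \<le> L * \<bar>v - u\<bar>"
    if "u \<in> {0..1}" "v \<in> {0..1}" for u v
    using lip1[of u v] lip1[of v u] that by (cases "u \<le> v") (auto simp: abs_minus_commute)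
  have der: "(deriv01 i f has_real_derivative deriv01 (Suc i) f z) (at z within {0..1})"
    if "i < s - 1" "z \<in> {0..1}" for i z
  proof -
    have "deriv01 i f differentiable (at z within {0..1})" using D' that by blast
    then show ?thesis
      by (simp add: deriv01_Suc vector_derivative_works has_real_derivative_iff_has_vector_derivative)
  qed
  have "\<bar>deriv01 (k + 0) f y - (\<Sum>l\<le>s - 1 - k. deriv01 (k + l) f x * (y - x) ^ l / fact l)\<bar>
      \<le> L * \<bar>y - x\<bar> ^ Suc (s - 1 - k)"
  proof (rule taylor_lipschitz[of "s - 1 - k" "{0..1}"])
    fix u v :: real assume "u \<in> {0..1}" "v \<in> {0..1}"
    then show "\<bar>deriv01 (k + (s - 1 - k)) f v - deriv01 (k + (s - 1 - k)) f u\<bar> \<le> L * \<bar>v - u\<bar>"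
      using lip[of u v] \<open>k < s\<close> by simp
  next
    fix i z assume "i < s - 1 - k" "z \<in> {0..1::real}"
    then show "(deriv01 (k + i) f has_real_derivative deriv01 (k + Suc i) f z) (at z within {0..1})"
      using der[of "k + i" z] by simp
  qed (use x y \<open>L > 0\<close> in auto)
  moreover have "Suc (s - 1 - k) = s - k" using \<open>k < s\<close> by simp
  ultimately show ?thesis by (simp only: lessThan_Suc_atMost[symmetric] add_0_right)
qed

subsection \<open>The bias\<close>

text \<open>The inner sum is the \<open>k\<close>-th derivative at \<open>w\<close> of the
  polynomial with derivatives \<open>a\<close> at \<open>p\<close>. Raising the degree adds one
  monomial, which the binomial theorem distributes over all \<open>k\<close>.\<close>

lemma taylor_polynomial_reexpand:
  fixes a :: "nat \<Rightarrow> real"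
  shows "(\<Sum>l<s. a l * (y - p) ^ l / fact l) =
    (\<Sum>k<s. (\<Sum>l<s - k. a (k + l) * (w - p) ^ l / fact l) * ((y - w) ^ k / fact k))"
proof (induction s)
  case 0
  then show ?case by simp
next
  case (Suc s)
  let ?c = "\<lambda>k l. a (k + l) * (w - p) ^ l / fact l * ((y - w) ^ k / fact k)"
  have "a s * (y - p) ^ s / fact s = (\<Sum>k\<le>s. ?c k (s - k))"
  proof -
    have "(y - p) ^ s = ((y - w) + (w - p)) ^ s" by simp
    also have "\<dots> = (\<Sum>k\<le>s. real (s choose k) * (y - w) ^ k * (w - p) ^ (s - k))"
      by (rule binomial_ring)
    finally have "a s * (y - p) ^ s / fact s =
        (\<Sum>k\<le>s. a s * (real (s choose k) * (y - w) ^ k * (w - p) ^ (s - k)) / fact s)"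
      by (simp add: sum_distrib_left sum_divide_distrib)
    also have "\<dots> = (\<Sum>k\<le>s. ?c k (s - k))"
      by (intro sum.cong) (auto simp: binomial_fact mult_ac)
    finally show ?thesis .
  qed
  also have "\<dots> = (\<Sum>k<s. ?c k (s - k)) + ?c s 0"
    by (simp flip: lessThan_Suc_atMost)
  \<comment> \<open>The new terms lie on \<open>k + l = s\<close>: each inner sum grows by one term,
    and \<open>k = s\<close> opens a new one.\<close>
  finally have "(\<Sum>l<Suc s. a l * (y - p) ^ l / fact l) =
      (\<Sum>k<s. (\<Sum>l<s - k. ?c k l) + ?c k (s - k)) + ?c s 0"
    unfolding sum.distrib sum_distrib_right[symmetric] by (simp add: Suc.IH)
  also have "\<dots> = (\<Sum>k<s. \<Sum>l<Suc s - k. ?c k l) + (\<Sum>l<Suc s - s. ?c s l)"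
    by (intro arg_cong2[where f = "(+)"] sum.cong) (auto simp: Suc_diff_le)
  also have "\<dots> = (\<Sum>k<Suc s. \<Sum>l<Suc s - k. ?c k l)"
    by simp
  finally show ?case by (simp only: sum_distrib_right)
qed

text \<open>The price of ignoring cancellation among the weights; it is paid for the Taylor error
  and in the case \<open>s = 0\<close>.\<close>

lemma sum_abs_jk_weight_le:
  assumes "N \<ge> 1"
  shows "(\<Sum>t\<le>q. \<bar>jk_weight q N t\<bar>) \<le> 2 ^ q * real (Suc q) ^ q * real N powr real q"
proof -
  have "\<bar>jk_weight q N t\<bar> \<le> real (q choose t) * (real (Suc q) ^ q * real N ^ q)" if "t \<le> q" for t
  proof -
    have "real t \<le> real q * real N"
      using that assms by (metis mult.right_neutral mult_le_mono of_nat_le_iff of_nat_mult)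
    then have "(real N + real t) ^ q \<le> (real (Suc q) * real N) ^ q"
      using assms by (intro power_mono) (auto simp: algebra_simps)
    then have "real (q choose t) * (real N + real t) ^ q / fact q \<le>
        real (q choose t) * (real (Suc q) ^ q * real N ^ q) / 1"
      unfolding power_mult_distrib by (intro frac_le mult_left_mono) auto
    then show ?thesis
      by (simp add: jk_weight_def abs_mult power_abs)
  qed
  then have "(\<Sum>t\<le>q. \<bar>jk_weight q N t\<bar>) \<le> (\<Sum>t\<le>q. real (q choose t) * (real (Suc q) ^ q * real N ^ q))"
    by (intro sum_mono) auto
  also have "\<dots> = real (\<Sum>t\<le>q. q choose t) * (real (Suc q) ^ q * real N ^ q)"
    by (simp add: sum_distrib_right)
  also have "\<dots> = 2 ^ q * real (Suc q) ^ q * real N powr real q"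
    using assms by (simp add: choose_row_sum powr_realpow)
  finally show ?thesis .
qed

text \<open>The central moment is a polynomial in \<open>m\<close> of degree at most
  \<open>k div 2\<close>; division by \<open>m ^ k\<close> leaves only powers of
  \<open>1 / m\<close> with positive exponents, whose weighted sums are already bounded.\<close>

lemma abs_jackknife_central_power_le:
  assumes "k \<ge> 1"
  shows "\<exists>K\<ge>0. \<forall>N\<ge>1. \<forall>p\<in>{0..1}.
    \<bar>\<Sum>t\<le>q. jk_weight q N t * bern_exp p (N + t) (\<lambda>j. (real j / (real N + real t) - p) ^ k)\<bar>
      \<le> K * real N powr (- real (Suc q))"
proof -
  obtain c where c: "\<And>b m. real (m choose b) = (\<Sum>l\<le>b. c b l * real m ^ l)"
    using binomial_eq_polynomial by metis
  have "\<exists>K\<ge>0. \<forall>N\<ge>1. \<bar>\<Sum>t\<le>q. jk_weight q N t / (real N + real t) ^ Suc d\<bar> \<le> K * real N powr (- real (Suc q))" for d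
    by (rule abs_sum_jk_weight_divide_power_le) simp
  then obtain K where K: "\<And>d. K d \<ge> 0" "\<And>d N. N \<ge> 1 \<Longrightarrow>
      \<bar>\<Sum>t\<le>q. jk_weight q N t / (real N + real t) ^ Suc d\<bar> \<le> K d * real N powr (- real (Suc q))"
    by metis
  define C where "C = (\<Sum>b\<le>k div 2. \<Sum>l\<le>b. real k ^ k * \<bar>c b l\<bar> * K (k - l - 1))"
  have "\<bar>\<Sum>t\<le>q. jk_weight q N t * bern_exp p (N + t) (\<lambda>j. (real j / (real N + real t) - p) ^ k)\<bar>
      \<le> C * real N powr (- real (Suc q))" if N: "N \<ge> 1" and p: "p \<in> {0..1}" for N p
  proof -
    define \<beta> where "\<beta> b = (fdiff ^^ b) (bern_moment p p k) 0" for b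
    have \<beta>: "\<bar>\<beta> b\<bar> \<le> real k ^ k" if "b \<le> k div 2" for b
    proof -
      have "b \<le> k" using that by simp
      then show ?thesis unfolding \<beta>_def by (rule abs_fdiff_bern_moment_le_const[OF p p])
    qed
    \<comment> \<open>The exponent \<open>k - l\<close> is written as \<open>Suc (k - l - 1)\<close>
      to show that it is positive, by \<open>l \<le> k div 2 < k\<close>.\<close>
    have ex: "bern_exp p (N + t) (\<lambda>j. (real j / (real N + real t) - p) ^ k) =
       (\<Sum>b\<le>k div 2. \<Sum>l\<le>b. \<beta> b * c b l * (1 / (real N + real t) ^ Suc (k - l - 1)))" for t
    proof -
      have "bern_exp p (N + t) (\<lambda>j. (real j / (real N + real t) - p) ^ k) =
          bern_moment p p k (N + t) / (real N + real t) ^ k"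
        using bern_exp_deviation_power[of "N + t" p k] N by simp
      also have "\<dots> = (\<Sum>b\<le>k div 2. (\<Sum>l\<le>b. c b l * (real N + real t) ^ l) * \<beta> b / (real N + real t) ^ k)"
        by (subst bern_moment_central_newton[OF p]) (simp add: \<beta>_def c sum_divide_distrib)
      also have "\<dots> = (\<Sum>b\<le>k div 2. \<Sum>l\<le>b. \<beta> b * c b l * ((real N + real t) ^ l / (real N + real t) ^ k))"
        unfolding sum_distrib_right sum_divide_distrib by (simp add: mult_ac)
      also have "\<dots> = (\<Sum>b\<le>k div 2. \<Sum>l\<le>b. \<beta> b * c b l * (1 / (real N + real t) ^ Suc (k - l - 1)))"
      proof (intro sum.cong refl arg_cong2[where f = "(*)"])
        fix b l assume "b \<in> {..k div 2}" "l \<in> {..b}"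
        then have "l \<le> k div 2" by simp
        then have k: "l + Suc (k - l - 1) = k" using assms by linarith
        have "(real N + real t) ^ k = (real N + real t) ^ l * (real N + real t) ^ Suc (k - l - 1)"
          using power_add[of "real N + real t" l "Suc (k - l - 1)"] unfolding k .
        then show "(real N + real t) ^ l / (real N + real t) ^ k = 1 / (real N + real t) ^ Suc (k - l - 1)"
          using N by simp
      qed
      finally show ?thesis .
    qed
    have "(\<Sum>t\<le>q. jk_weight q N t * bern_exp p (N + t) (\<lambda>j. (real j / (real N + real t) - p) ^ k)) =
        (\<Sum>t\<le>q. \<Sum>b\<le>k div 2. \<Sum>l\<le>b. \<beta> b * c b l * (jk_weight q N t / (real N + real t) ^ Suc (k - l - 1)))"
      unfolding ex sum_distrib_left by (intro sum.cong refl) simp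
    also have "\<dots> = (\<Sum>b\<le>k div 2. \<Sum>l\<le>b. \<beta> b * c b l *
        (\<Sum>t\<le>q. jk_weight q N t / (real N + real t) ^ Suc (k - l - 1)))"
      unfolding sum_distrib_left sum.swap[of _ "{..k div 2}" "{..q}"]
      by (intro sum.cong refl sum.swap)
    finally have eq: "(\<Sum>t\<le>q. jk_weight q N t * bern_exp p (N + t) (\<lambda>j. (real j / (real N + real t) - p) ^ k)) =
        (\<Sum>b\<le>k div 2. \<Sum>l\<le>b. \<beta> b * c b l *
        (\<Sum>t\<le>q. jk_weight q N t / (real N + real t) ^ Suc (k - l - 1)))" .
    have "\<bar>\<Sum>t\<le>q. jk_weight q N t * bern_exp p (N + t) (\<lambda>j. (real j / (real N + real t) - p) ^ k)\<bar> \<le> (\<Sum>b\<le>k div 2. \<Sum>l\<le>b. real k ^ k * \<bar>c b l\<bar> *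
        (K (k - l - 1) * real N powr (- real (Suc q))))"
      unfolding eq
    proof (intro abs_sum_le)
      fix b l assume b: "b \<in> {..k div 2}" and "l \<in> {..b}"
      show "\<bar>\<beta> b * c b l * (\<Sum>t\<le>q. jk_weight q N t / (real N + real t) ^ Suc (k - l - 1))\<bar>
         \<le> real k ^ k * \<bar>c b l\<bar> * (K (k - l - 1) * real N powr (- real (Suc q)))"
        unfolding abs_mult
      proof (rule mult_mono)
        show "\<bar>\<beta> b\<bar> * \<bar>c b l\<bar> \<le> real k ^ k * \<bar>c b l\<bar>"
          using b by (intro mult_right_mono \<beta>) simp_all
        show "\<bar>\<Sum>t\<le>q. jk_weight q N t / (real N + real t) ^ Suc (k - l - 1)\<bar>
            \<le> K (k - l - 1) * real N powr (- real (Suc q))"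
          by (rule K(2)[OF N])
      qed simp_all
    qed
    also have "\<dots> = C * real N powr (- real (Suc q))"
      unfolding C_def sum_distrib_right by (simp only: mult.assoc)
    finally show ?thesis .
  qed
  moreover have "C \<ge> 0" unfolding C_def using K(1) by (intro sum_nonneg) auto
  ultimately show ?thesis by blast
qed

text \<open>\<open>F k\<close> stands for the \<open>k\<close>-th derivative. Only its Taylor bounds
  enter, and \<open>K\<close> is chosen before \<open>F\<close>, which makes it uniform over the
  whole class.\<close>

lemma abs_jackknife_remainder_le:
  assumes "L > 0" "s \<ge> 1"
  shows "\<exists>K\<ge>0. \<forall>F N p.
    (\<forall>k<s. \<forall>x\<in>{0..1}. \<forall>y\<in>{0..1}.
       \<bar>F k y - (\<Sum>l<s - k. F (k + l) x * (y - x) ^ l / fact l)\<bar> \<le> L * \<bar>y - x\<bar> ^ (s - k)) \<longrightarrow>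
    N \<ge> 1 \<longrightarrow> p \<in> {0..1} \<longrightarrow>
    \<bar>\<Sum>t\<le>q. jk_weight q N t * bern_exp p (N + t) (\<lambda>j.
        F 0 (real j / (real N + real t)) - (\<Sum>l<s. F l p * (real j / (real N + real t) - p) ^ l / fact l))\<bar>
      \<le> K * (real N powr (- real s / 2) + real N powr (real q - real s))"
proof -
  have "\<forall>k. \<exists>K. K \<ge> 0 \<and> (\<forall>N\<ge>1. \<forall>p\<in>{0..1}. \<forall>w\<in>{0..1}.
     \<bar>\<Sum>t\<le>q. jk_weight q N t / (real N + real t) ^ k * bern_moment p w k t\<bar> \<le>
     K * (\<Sum>b\<le>q. real N powr (real b - real k) * \<bar>p - w\<bar> ^ (2 * b - k)))"
    by (rule allI) (rule abs_sum_jk_weight_bern_moment_le)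
  from choice[OF this] obtain K where "\<forall>k. K k \<ge> 0 \<and> (\<forall>N\<ge>1. \<forall>p\<in>{0..1}. \<forall>w\<in>{0..1}.
     \<bar>\<Sum>t\<le>q. jk_weight q N t / (real N + real t) ^ k * bern_moment p w k t\<bar> \<le>
     K k * (\<Sum>b\<le>q. real N powr (real b - real k) * \<bar>p - w\<bar> ^ (2 * b - k)))" ..
  then have K: "K k \<ge> 0" "N \<ge> 1 \<Longrightarrow> p \<in> {0..1} \<Longrightarrow> w \<in> {0..1} \<Longrightarrow>
     \<bar>\<Sum>t\<le>q. jk_weight q N t / (real N + real t) ^ k * bern_moment p w k t\<bar> \<le>
     K k * (\<Sum>b\<le>q. real N powr (real b - real k) * \<bar>p - w\<bar> ^ (2 * b - k))" for k N p w
    by blast+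
  have "\<forall>a. \<exists>A. A \<ge> 0 \<and> (\<forall>p\<in>{0..1}. \<forall>N\<ge>1.
     bern_exp p N (\<lambda>j. \<bar>real j / real N - p\<bar> ^ a) \<le> A * real N powr (- real a / 2))"
    by (rule allI) (rule bern_exp_abs_deviation_le)
  from choice[OF this] obtain A where "\<forall>a. A a \<ge> 0 \<and> (\<forall>p\<in>{0..1}. \<forall>N\<ge>1.
     bern_exp p N (\<lambda>j. \<bar>real j / real N - p\<bar> ^ a) \<le> A a * real N powr (- real a / 2))" ..
  then have A: "A a \<ge> 0" "p \<in> {0..1} \<Longrightarrow> N \<ge> 1 \<Longrightarrow>
     bern_exp p N (\<lambda>j. \<bar>real j / real N - p\<bar> ^ a) \<le> A a * real N powr (- real a / 2)" for a p N
    by blast+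
  define C1 where "C1 = (\<Sum>k<s. \<Sum>b\<le>q. L * K k * A (s - k + (2 * b - k)))"
  define C2 where "C2 = 2 ^ q * real (Suc q) ^ q * (L * real q ^ s)"
  have C1: "C1 \<ge> 0" unfolding C1_def using K(1) A(1) assms by (intro sum_nonneg) auto
  have C2: "C2 \<ge> 0" unfolding C2_def using assms by simp
  have "\<bar>\<Sum>t\<le>q. jk_weight q N t * bern_exp p (N + t) (\<lambda>j.
        F 0 (real j / (real N + real t)) - (\<Sum>l<s. F l p * (real j / (real N + real t) - p) ^ l / fact l))\<bar>
      \<le> C1 * real N powr (- real s / 2) + C2 * real N powr (real q - real s)"
    if F: "\<And>k x y. k < s \<Longrightarrow> x \<in> {0..1} \<Longrightarrow> y \<in> {0..1} \<Longrightarrow>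
       \<bar>F k y - (\<Sum>l<s - k. F (k + l) x * (y - x) ^ l / fact l)\<bar> \<le> L * \<bar>y - x\<bar> ^ (s - k)"
      and N: "N \<ge> 1" and p: "p \<in> {0..1}" for F :: "nat \<Rightarrow> real \<Rightarrow> real" and N p
  proof -
    \<comment> \<open>\<open>R\<close> is the Taylor remainder at \<open>p\<close>,
      \<open>Rk k w\<close> acts as its \<open>k\<close>-th derivative at \<open>w\<close>, and
      \<open>err\<close> is the error of expanding \<open>F 0\<close> around
      \<open>w\<close>.\<close>
    define R where "R y = F 0 y - (\<Sum>l<s. F l p * (y - p) ^ l / fact l)" for y
    define Rk where "Rk k w = F k w - (\<Sum>l<s - k. F (k + l) p * (w - p) ^ l / fact l)" for k w
    define err where "err w y = F 0 y - (\<Sum>l<s. F l w * (y - w) ^ l / fact l)" for w y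
    have Rk: "\<bar>Rk k w\<bar> \<le> L * \<bar>w - p\<bar> ^ (s - k)" if "k < s" "w \<in> {0..1}" for k w
      unfolding Rk_def using F[OF that(1) p that(2)] .
    have err: "\<bar>err w y\<bar> \<le> L * \<bar>y - w\<bar> ^ s" if "w \<in> {0..1}" "y \<in> {0..1}" for w y
      unfolding err_def using F[of 0 w y] that assms by simp
    have Rexp: "R y = (\<Sum>k<s. Rk k w / fact k * (y - w) ^ k) + err w y" for y w
      unfolding R_def Rk_def err_def taylor_polynomial_reexpand[of "\<lambda>l. F l p" y p s w]
      by (simp add: left_diff_distrib diff_divide_distrib sum_subtractf)
    \<comment> \<open>The jackknife sum conditioned on \<open>j\<close> successes among the first
      \<open>N\<close> samples. The centre \<open>j / N\<close> is then fixed, and the differencing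
      concerns only the \<open>t\<close> further samples.\<close>
    define G where "G j = (\<Sum>t\<le>q. jk_weight q N t * bern_exp p t (\<lambda>i. R (real (j + i) / (real N + real t))))" for j
    have "(\<Sum>t\<le>q. jk_weight q N t * bern_exp p (N + t) (\<lambda>j. R (real j / (real N + real t)))) = bern_exp p N G"
      unfolding bern_exp_split G_def bern_exp_sum ..
    then have "\<bar>\<Sum>t\<le>q. jk_weight q N t * bern_exp p (N + t) (\<lambda>j. R (real j / (real N + real t)))\<bar> =
        \<bar>bern_exp p N G\<bar>"
      by (rule arg_cong)
    also have "\<bar>bern_exp p N G\<bar> \<le> bern_exp p N (\<lambda>j.
       (\<Sum>k<s. L * K k * (\<Sum>b\<le>q. real N powr (real b - real k) * \<bar>real j / real N - p\<bar> ^ (s - k + (2 * b - k))))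
        + C2 * real N powr (real q - real s))"
    proof (rule abs_bern_exp_le[OF p])
      fix j assume j: "j \<le> N"
      define w where "w = real j / real N"
      have w: "w \<in> {0..1}" using j N by (simp add: w_def divide_le_eq_1)
      \<comment> \<open>The deviation from \<open>w\<close> is exactly the centred sum of the
        further samples over \<open>N + t\<close>, so its powers average to
        \<open>bern_moment\<close>.\<close>
      have yw: "real (j + i) / (real N + real t) - w = (real i - real t * w) / (real N + real t)" for i t
        using N by (simp add: w_def field_simps)
      have ex: "bern_exp p t (\<lambda>i. R (real (j + i) / (real N + real t))) =
         (\<Sum>k<s. Rk k w / fact k * (bern_moment p w k t / (real N + real t) ^ k)) +
         bern_exp p t (\<lambda>i. err w (real (j + i) / (real N + real t)))" for t
      proof -
        have "bern_exp p t (\<lambda>i. R (real (j + i) / (real N + real t))) =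
          bern_exp p t (\<lambda>i. (\<Sum>k<s. Rk k w / fact k / (real N + real t) ^ k * (real i - real t * w) ^ k) +
             err w (real (j + i) / (real N + real t)))"
          unfolding Rexp[of _ w] yw power_divide by simp
        then show ?thesis
          unfolding bern_exp_add bern_exp_sum bern_moment_def by simp
      qed
      have "G j = (\<Sum>t\<le>q. \<Sum>k<s. Rk k w / fact k * (jk_weight q N t / (real N + real t) ^ k * bern_moment p w k t)) +
          (\<Sum>t\<le>q. jk_weight q N t * bern_exp p t (\<lambda>i. err w (real (j + i) / (real N + real t))))"
        unfolding G_def ex by (simp add: distrib_left sum.distrib sum_distrib_left mult_ac)
      also have "(\<Sum>t\<le>q. \<Sum>k<s. Rk k w / fact k * (jk_weight q N t / (real N + real t) ^ k * bern_moment p w k t))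
         = (\<Sum>k<s. Rk k w / fact k * (\<Sum>t\<le>q. jk_weight q N t / (real N + real t) ^ k * bern_moment p w k t))"
        unfolding sum_distrib_left by (rule sum.swap)
      finally have "\<bar>G j\<bar> \<le>
         \<bar>\<Sum>k<s. Rk k w / fact k * (\<Sum>t\<le>q. jk_weight q N t / (real N + real t) ^ k * bern_moment p w k t)\<bar> +
         \<bar>\<Sum>t\<le>q. jk_weight q N t * bern_exp p t (\<lambda>i. err w (real (j + i) / (real N + real t)))\<bar>"
        by simp
      also have "\<bar>\<Sum>k<s. Rk k w / fact k * (\<Sum>t\<le>q. jk_weight q N t / (real N + real t) ^ k * bern_moment p w k t)\<bar>
         \<le> (\<Sum>k<s. L * K k * (\<Sum>b\<le>q. real N powr (real b - real k) * \<bar>w - p\<bar> ^ (s - k + (2 * b - k))))"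
      proof (intro abs_sum_le)
        fix k assume k: "k \<in> {..<s}"
        have "\<bar>Rk k w / fact k\<bar> \<le> \<bar>Rk k w\<bar> / 1"
          unfolding abs_divide by (intro frac_le) auto
        also have "\<dots> \<le> L * \<bar>w - p\<bar> ^ (s - k)"
          using Rk k w by simp
        finally have "\<bar>Rk k w / fact k * (\<Sum>t\<le>q. jk_weight q N t / (real N + real t) ^ k * bern_moment p w k t)\<bar>
           \<le> (L * \<bar>w - p\<bar> ^ (s - k)) * (K k * (\<Sum>b\<le>q. real N powr (real b - real k) * \<bar>p - w\<bar> ^ (2 * b - k)))"
          unfolding abs_mult using assms by (intro mult_mono K(2) N p w) auto
        also have "\<dots> = L * K k * (\<Sum>b\<le>q. real N powr (real b - real k) * \<bar>w - p\<bar> ^ (s - k + (2 * b - k)))"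
          by (simp add: sum_distrib_left power_add abs_minus_commute mult_ac)
        finally show "\<bar>Rk k w / fact k * (\<Sum>t\<le>q. jk_weight q N t / (real N + real t) ^ k * bern_moment p w k t)\<bar>
           \<le> L * K k * (\<Sum>b\<le>q. real N powr (real b - real k) * \<bar>w - p\<bar> ^ (s - k + (2 * b - k)))" .
      qed
      \<comment> \<open>No cancellation is used for the error: at most \<open>q\<close> further
        samples move the mean by at most \<open>q / N\<close>.\<close>
      also have "\<bar>\<Sum>t\<le>q. jk_weight q N t * bern_exp p t (\<lambda>i. err w (real (j + i) / (real N + real t)))\<bar>
         \<le> (\<Sum>t\<le>q. \<bar>jk_weight q N t\<bar> * (L * (real q / real N) ^ s))"
      proof (intro abs_sum_le)
        fix t assume t: "t \<in> {..q}"
        have "\<bar>bern_exp p t (\<lambda>i. err w (real (j + i) / (real N + real t)))\<bar> \<le> bern_exp p t (\<lambda>i. L * (real q / real N) ^ s)"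
        proof (rule abs_bern_exp_le[OF p])
          fix i assume i: "i \<le> t"
          let ?y = "real (j + i) / (real N + real t)"
          have y: "?y \<in> {0..1}" using i j N by (simp add: divide_le_eq_1)
          have "0 \<le> real t * w" "real t * w \<le> real t"
            using w by (auto simp: mult_left_le)
          then have "\<bar>real i - real t * w\<bar> \<le> real q"
            using i t by auto
          then have "\<bar>?y - w\<bar> \<le> real q / real N"
            unfolding yw abs_divide using N by (intro frac_le) auto
          then have "L * \<bar>?y - w\<bar> ^ s \<le> L * (real q / real N) ^ s"
            using assms by (intro mult_left_mono power_mono) auto
          then show "\<bar>err w ?y\<bar> \<le> L * (real q / real N) ^ s"
            using err[OF w y] by linarith
        qed
        then show "\<bar>jk_weight q N t * bern_exp p t (\<lambda>i. err w (real (j + i) / (real N + real t)))\<bar>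
           \<le> \<bar>jk_weight q N t\<bar> * (L * (real q / real N) ^ s)"
          unfolding abs_mult by (intro mult_left_mono) auto
      qed
      also have "\<dots> = (\<Sum>t\<le>q. \<bar>jk_weight q N t\<bar>) * (L * (real q / real N) ^ s)"
        by (simp add: sum_distrib_right)
      also have "\<dots> \<le> (2 ^ q * real (Suc q) ^ q * real N powr real q) * (L * (real q / real N) ^ s)"
        using assms by (intro mult_right_mono sum_abs_jk_weight_le N) auto
      also have "\<dots> = C2 * real N powr (real q - real s)"
        using N by (simp add: C2_def power_divide powr_diff powr_realpow)
      finally show "\<bar>G j\<bar> \<le>
         (\<Sum>k<s. L * K k * (\<Sum>b\<le>q. real N powr (real b - real k) * \<bar>real j / real N - p\<bar> ^ (s - k + (2 * b - k))))
         + C2 * real N powr (real q - real s)"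
        unfolding w_def by simp
    qed
    also have "\<dots> = (\<Sum>k<s. L * K k * (\<Sum>b\<le>q. real N powr (real b - real k) *
        bern_exp p N (\<lambda>j. \<bar>real j / real N - p\<bar> ^ (s - k + (2 * b - k))))) + C2 * real N powr (real q - real s)"
      unfolding bern_exp_add bern_exp_sum by simp
    also have "(\<Sum>k<s. L * K k * (\<Sum>b\<le>q. real N powr (real b - real k) *
        bern_exp p N (\<lambda>j. \<bar>real j / real N - p\<bar> ^ (s - k + (2 * b - k)))))
        \<le> (\<Sum>k<s. L * K k * (\<Sum>b\<le>q. A (s - k + (2 * b - k)) * real N powr (- real s / 2)))"
    proof (intro sum_mono mult_left_mono)
      fix k b assume k: "k \<in> {..<s}"
      let ?a = "s - k + (2 * b - k)"
      have "real N powr (real b - real k) * bern_exp p N (\<lambda>j. \<bar>real j / real N - p\<bar> ^ ?a) \<le>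
         real N powr (real b - real k) * (A ?a * real N powr (- real ?a / 2))"
        by (intro mult_left_mono A(2) p N) auto
      also have "\<dots> = A ?a * real N powr (real b - real k + - real ?a / 2)"
        by (simp only: powr_add mult.left_commute)
      also have "\<dots> \<le> A ?a * real N powr (- real s / 2)"
      proof (intro mult_left_mono powr_mono A(1))
        \<comment> \<open>Truncated subtraction can only increase \<open>?a\<close>, and the
          untruncated value gives exactly the exponent \<open>- s / 2\<close>.\<close>
        have "real ?a \<ge> real s - real k + (2 * real b - real k)"
          using k by simp
        moreover have "real b - real k + - z / 2 \<le> - real s / 2"
          if "z \<ge> real s - real k + (2 * real b - real k)" for z
          using that by linarith
        ultimately show "real b - real k + - real ?a / 2 \<le> - real s / 2" by blast
      qed (use N in auto)
      finally show "real N powr (real b - real k) * bern_exp p N (\<lambda>j. \<bar>real j / real N - p\<bar> ^ ?a)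
         \<le> A ?a * real N powr (- real s / 2)" .
    qed (use K(1) assms in auto)
    also have "\<dots> = C1 * real N powr (- real s / 2)"
      by (simp add: C1_def sum_distrib_left sum_distrib_right mult_ac)
    finally show ?thesis unfolding R_def by simp
  qed
  note main = this
  have comb: "C1 * u + C2 * v \<le> (C1 + C2) * (u + v)" if "u \<ge> 0" "v \<ge> 0" for u v :: real
    using C1 C2 that by (simp add: algebra_simps)
  have "\<bar>\<Sum>t\<le>q. jk_weight q N t * bern_exp p (N + t) (\<lambda>j.
        F 0 (real j / (real N + real t)) - (\<Sum>l<s. F l p * (real j / (real N + real t) - p) ^ l / fact l))\<bar>
      \<le> (C1 + C2) * (real N powr (- real s / 2) + real N powr (real q - real s))"
    if "\<forall>k<s. \<forall>x\<in>{0..1}. \<forall>y\<in>{0..1}.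
       \<bar>F k y - (\<Sum>l<s - k. F (k + l) x * (y - x) ^ l / fact l)\<bar> \<le> L * \<bar>y - x\<bar> ^ (s - k)"
      "N \<ge> 1" "p \<in> {0..1}" for F :: "nat \<Rightarrow> real \<Rightarrow> real" and N p
    by (rule order_trans[OF main comb]) (use that in simp_all)
  then show ?thesis
    using C1 C2 by (intro exI[of _ "C1 + C2"] conjI allI impI) simp_all
qed

lemma jackknife_bias_le:
  assumes L: "L > 0"
  shows "\<exists>M\<ge>0. \<forall>f n p. condition_D s L f \<longrightarrow> n \<ge> Suc q \<longrightarrow> p \<in> {0..1} \<longrightarrow>
    \<bar>jackknife_mean (Suc q) n f p - f p\<bar> \<le>
      M * (real (n - q) powr (- real (Suc q)) + (real (n - q) powr (- real s / 2) + real (n - q) powr (real q - real s)))"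
\<comment> \<open>For \<open>s = 0\<close> there is no expansion; boundedness of \<open>f\<close>
  and the size of the weights give the term \<open>N powr (q - s)\<close>.\<close>
proof (cases "s = 0")
  case True
  define W where "W = 2 ^ q * real (Suc q) ^ q"
  have W: "W \<ge> 0" by (simp add: W_def)
  have "\<bar>jackknife_mean (Suc q) n f p - f p\<bar> \<le>
      (W * L + L) * (real (n - q) powr (- real (Suc q)) + (real (n - q) powr (- real s / 2) + real (n - q) powr (real q - real s)))"
    if D: "condition_D s L f" and n: "n \<ge> Suc q" and p: "p \<in> {0..1}" for f n p
  proof -
    let ?N = "n - q"
    have N: "?N \<ge> 1" using n by simp
    have f: "\<bar>f x\<bar> \<le> L" if "x \<in> {0..1}" for x
      using D True that by (simp add: condition_D_def)
    have "\<bar>jackknife_mean (Suc q) n f p\<bar> \<le> (\<Sum>t\<le>q. \<bar>jk_weight q ?N t\<bar> * L)"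
      unfolding jackknife_mean_eq_bern_exp[OF n p]
    proof (intro abs_sum_le)
      fix t
      have "\<bar>bern_exp p (?N + t) (\<lambda>j. f (real j / (real ?N + real t)))\<bar> \<le> bern_exp p (?N + t) (\<lambda>j. L)"
      proof (rule abs_bern_exp_le[OF p])
        fix j assume "j \<le> ?N + t"
        then have "real j \<le> real ?N + real t" by linarith
        then show "\<bar>f (real j / (real ?N + real t))\<bar> \<le> L"
          using N by (intro f) (simp add: divide_le_eq_1 add_pos_nonneg)
      qed
      then show "\<bar>jk_weight q ?N t * bern_exp p (?N + t) (\<lambda>j. f (real j / (real ?N + real t)))\<bar>
          \<le> \<bar>jk_weight q ?N t\<bar> * L"
        unfolding abs_mult by (intro mult_left_mono) simp_all
    qed
    also have "\<dots> = (\<Sum>t\<le>q. \<bar>jk_weight q ?N t\<bar>) * L"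
      by (rule sum_distrib_right[symmetric])
    also have "\<dots> \<le> (W * real ?N powr real q) * L"
      unfolding W_def using L by (intro mult_right_mono sum_abs_jk_weight_le N) simp
    finally have "\<bar>jackknife_mean (Suc q) n f p\<bar> \<le> W * L * real ?N powr real q"
      by (simp only: mult_ac)
    moreover have "\<bar>f p\<bar> \<le> L * real ?N powr real q"
    proof -
      have "1 \<le> real ?N powr real q"
        using N by (intro ge_one_powr_ge_zero) auto
      then have "L * 1 \<le> L * real ?N powr real q"
        using L by (intro mult_left_mono) auto
      then show ?thesis using f[OF p] by linarith
    qed
    ultimately have "\<bar>jackknife_mean (Suc q) n f p - f p\<bar> \<le> (W * L + L) * real ?N powr real q"
      unfolding distrib_right by linarith
    also have "\<dots> \<le> (W * L + L) * (real ?N powr (- real (Suc q)) + (real ?N powr (- real s / 2) + real ?N powr (real q - real s)))"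
      using W L True by (intro mult_left_mono) simp_all
    finally show ?thesis .
  qed
  then show ?thesis
    using W L by (intro exI[of _ "W * L + L"] conjI allI impI) simp_all
next
  case False
  then have s: "s \<ge> 1" by simp
  obtain K where K: "K \<ge> 0" and K': "\<forall>F N p.
    (\<forall>k<s. \<forall>x\<in>{0..1}. \<forall>y\<in>{0..1}.
       \<bar>F k y - (\<Sum>l<s - k. F (k + l) x * (y - x) ^ l / fact l)\<bar> \<le> L * \<bar>y - x\<bar> ^ (s - k)) \<longrightarrow>
    N \<ge> 1 \<longrightarrow> p \<in> {0..1} \<longrightarrow>
    \<bar>\<Sum>t\<le>q. jk_weight q N t * bern_exp p (N + t) (\<lambda>j.
        F 0 (real j / (real N + real t)) - (\<Sum>l<s. F l p * (real j / (real N + real t) - p) ^ l / fact l))\<bar>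
      \<le> K * (real N powr (- real s / 2) + real N powr (real q - real s))"
    using abs_jackknife_remainder_le[OF L s, of q] by (elim exE conjE)
  have "\<forall>k. \<exists>P. P \<ge> 0 \<and> (\<forall>N\<ge>1. \<forall>p\<in>{0..1}.
    \<bar>\<Sum>t\<le>q. jk_weight q N t * bern_exp p (N + t) (\<lambda>j. (real j / (real N + real t) - p) ^ Suc k)\<bar>
      \<le> P * real N powr (- real (Suc q)))"
    by (intro allI abs_jackknife_central_power_le) simp
  from choice[OF this] obtain P where "\<forall>k. P k \<ge> 0 \<and> (\<forall>N\<ge>1. \<forall>p\<in>{0..1}.
    \<bar>\<Sum>t\<le>q. jk_weight q N t * bern_exp p (N + t) (\<lambda>j. (real j / (real N + real t) - p) ^ Suc k)\<bar>
      \<le> P k * real N powr (- real (Suc q)))" ..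
  then have P: "P k \<ge> 0" "N \<ge> 1 \<Longrightarrow> p \<in> {0..1} \<Longrightarrow>
    \<bar>\<Sum>t\<le>q. jk_weight q N t * bern_exp p (N + t) (\<lambda>j. (real j / (real N + real t) - p) ^ Suc k)\<bar>
      \<le> P k * real N powr (- real (Suc q))" for k N p
    by blast+
  define Q where "Q = (\<Sum>l<s - 1. L * P l)"
  have Q: "Q \<ge> 0" unfolding Q_def using P(1) L by (intro sum_nonneg) simp
  have "\<bar>jackknife_mean (Suc q) n f p - f p\<bar> \<le>
      (Q + K) * (real (n - q) powr (- real (Suc q)) + (real (n - q) powr (- real s / 2) + real (n - q) powr (real q - real s)))"
    if D: "condition_D s L f" and n: "n \<ge> Suc q" and p: "p \<in> {0..1}" for f n p
  proof -
    define N where "N = n - q"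
    have N: "N \<ge> 1" using n by (simp add: N_def)
    define F where "F k = deriv01 k f" for k
    have F0: "F 0 = f" by (simp add: F_def deriv01_def)
    have FL: "\<bar>F k p\<bar> \<le> L" if "k < s" for k
      using D False that p by (simp add: condition_D_def F_def)
    define y where "y t j = real j / (real N + real t)" for t j
    define m where "m l = (\<Sum>t\<le>q. jk_weight q N t * bern_exp p (N + t) (\<lambda>j. (y t j - p) ^ l))" for l
    let ?R = "\<Sum>t\<le>q. jk_weight q N t * bern_exp p (N + t) (\<lambda>j.
        F 0 (y t j) - (\<Sum>l<s. F l p * (y t j - p) ^ l / fact l))"
    have R: "\<bar>?R\<bar> \<le> K * (real N powr (- real s / 2) + real N powr (real q - real s))"
      unfolding y_def
    proof (rule K'[rule_format])
      fix k u v assume "k < s" "u \<in> {0..1::real}" "v \<in> {0..1::real}"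
      then show "\<bar>F k v - (\<Sum>l<s - k. F (k + l) u * (v - u) ^ l / fact l)\<bar> \<le> L * \<bar>v - u\<bar> ^ (s - k)"
        unfolding F_def by (rule condition_D_imp_taylor[OF D L])
    qed (use N p in auto)
    have "jackknife_mean (Suc q) n f p = (\<Sum>t\<le>q. jk_weight q N t * bern_exp p (N + t) (\<lambda>j. F 0 (y t j)))"
      unfolding jackknife_mean_eq_bern_exp[OF n p] F0 y_def N_def ..
    also have "\<dots> = ?R + (\<Sum>t\<le>q. jk_weight q N t * bern_exp p (N + t) (\<lambda>j. \<Sum>l<s. F l p / fact l * (y t j - p) ^ l))"
      unfolding bern_exp_diff by (simp add: right_diff_distrib sum_subtractf)
    also have "(\<Sum>t\<le>q. jk_weight q N t * bern_exp p (N + t) (\<lambda>j. \<Sum>l<s. F l p / fact l * (y t j - p) ^ l)) =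
        (\<Sum>l<s. F l p / fact l * m l)"
      unfolding bern_exp_sum m_def sum_distrib_left
      by (subst sum.swap) (simp only: mult.left_commute)
    \<comment> \<open>The term of order 0 yields \<open>f p\<close> itself because the weights sum
      to one; orders 1 to \<open>s - 1\<close> remain.\<close>
    also have "\<dots> = f p + (\<Sum>l<s - 1. F (Suc l) p / fact (Suc l) * m (Suc l))"
    proof -
      have "m 0 = 1"
        using sum_jk_weight_eq_1[OF N, of q] by (simp add: m_def)
      then show ?thesis
        using s sum.lessThan_Suc_shift[of "\<lambda>l. F l p / fact l * m l" "s - 1"]
        by (simp add: F0 del: fact_Suc)
    qed
    finally have "jackknife_mean (Suc q) n f p - f p = ?R + (\<Sum>l<s - 1. F (Suc l) p / fact (Suc l) * m (Suc l))"
      by simp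
    moreover have "\<bar>\<Sum>l<s - 1. F (Suc l) p / fact (Suc l) * m (Suc l)\<bar> \<le> (\<Sum>l<s - 1. L * P l * real N powr (- real (Suc q)))"
    proof (intro abs_sum_le)
      fix l assume l: "l \<in> {..<s - 1}"
      have "\<bar>F (Suc l) p / fact (Suc l)\<bar> \<le> L / 1"
        unfolding abs_divide using FL[of "Suc l"] l L fact_ge_1[of "Suc l", where 'a = real]
        by (intro frac_le) (simp_all del: fact_Suc)
      moreover have "\<bar>m (Suc l)\<bar> \<le> P l * real N powr (- real (Suc q))"
        unfolding m_def y_def by (rule P(2)[OF N p])
      ultimately show "\<bar>F (Suc l) p / fact (Suc l) * m (Suc l)\<bar> \<le> L * P l * real N powr (- real (Suc q))"
        unfolding abs_mult mult.assoc using L by (intro mult_mono) simp_all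
    qed
    then have "\<bar>\<Sum>l<s - 1. F (Suc l) p / fact (Suc l) * m (Suc l)\<bar> \<le> Q * real N powr (- real (Suc q))"
      unfolding Q_def sum_distrib_right .
    ultimately have "\<bar>jackknife_mean (Suc q) n f p - f p\<bar> \<le>
        Q * real N powr (- real (Suc q)) + K * (real N powr (- real s / 2) + real N powr (real q - real s))"
      using R by linarith
    also have "\<dots> \<le> (Q + K) * real N powr (- real (Suc q)) +
        (Q + K) * (real N powr (- real s / 2) + real N powr (real q - real s))"
      using Q K by (intro add_mono mult_right_mono) simp_all
    finally show ?thesis
      unfolding N_def[symmetric] distrib_left[of "Q + K" "real N powr (- real (Suc q))"] .
  qed
  then show ?thesis
    using Q K by (intro exI[of _ "Q + K"] conjI allI impI) simp_all
qed

section \<open>Comparison with the claimed rate\<close>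

text \<open>Since \<open>n \<le> (q + 1) (n - q)\<close>, powers of \<open>n - q\<close> and of
  \<open>n\<close> agree up to constants. The largest of the three exponents is
  \<open>q - s\<close>, \<open>- s / 2\<close> or \<open>- (q + 1)\<close> in the respective cases
  of the rate.\<close>

lemma powr_le_jackknife_rate:
  assumes n: "n \<ge> Suc q" and e: "e \<in> {- real (Suc q), - real s / 2, real q - real s}"
  shows "real (n - q) powr e \<le> real (Suc q) powr \<bar>e\<bar> * jackknife_rate (Suc q) s n"
proof -
  have "n - q \<ge> 1" using n by simp
  then have "q * 1 \<le> q * (n - q)" by (intro mult_le_mono) simp_all
  then have "n \<le> Suc q * (n - q)" using n unfolding mult_Suc by linarith
  then have "real n \<le> real (Suc q) * real (n - q)"
    by (metis of_nat_le_iff of_nat_mult)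
  \<comment> \<open>The larger quantity \<open>n\<close> must be the one bounded above, so the
    comparison is made for \<open>- e\<close> and then inverted.\<close>
  then have "real n powr - e \<le> real (Suc q) powr \<bar>- e\<bar> * real (n - q) powr - e"
    using n by (intro powr_le_comparable) simp_all
  then have "real (n - q) powr e \<le> real (Suc q) powr \<bar>e\<bar> * real n powr e"
    using n by (simp add: powr_minus field_simps del: of_nat_Suc of_nat_diff)
  also have "real n powr e \<le> jackknife_rate (Suc q) s n"
    using n e unfolding jackknife_rate_def by (auto simp: field_simps intro!: powr_mono)
  finally show ?thesis by simp
qed

theorem theorem3:
  fixes r s :: nat and L :: real
  assumes "r \<ge> 1" and "L > 0"
  shows "\<exists>M>0. \<forall>f :: real \<Rightarrow> real. condition_D s L f \<longrightarrow>
           (\<forall>n\<ge>r. sup_norm01 (\<lambda>p. jackknife_mean r n f p - f p) \<le> ereal (M * jackknife_rate r s n))"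
proof -
  obtain q where r: "r = Suc q" using assms(1) by (cases r) auto
  obtain M where M: "M \<ge> 0" and bias: "\<And>f n p. condition_D s L f \<Longrightarrow> n \<ge> Suc q \<Longrightarrow> p \<in> {0..1} \<Longrightarrow>
    \<bar>jackknife_mean (Suc q) n f p - f p\<bar> \<le>
      M * (real (n - q) powr (- real (Suc q)) + (real (n - q) powr (- real s / 2) + real (n - q) powr (real q - real s)))"
    using jackknife_bias_le[OF assms(2), of s q] by blast
  define C where "C = real (Suc q) powr \<bar>- real (Suc q)\<bar> +
    (real (Suc q) powr \<bar>- real s / 2\<bar> + real (Suc q) powr \<bar>real q - real s\<bar>)"
  have C: "C \<ge> 0" by (simp add: C_def)
  \<comment> \<open>The summand 1 makes the constant positive even if \<open>M\<close> is
    zero.\<close>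
  have "sup_norm01 (\<lambda>p. jackknife_mean r n f p - f p) \<le> ereal ((M * C + 1) * jackknife_rate r s n)"
    if D: "condition_D s L f" and n: "n \<ge> r" for f n
    unfolding sup_norm01_def
  proof (rule SUP_least)
    fix p :: real assume p: "p \<in> {0..1}"
    have n': "n \<ge> Suc q" using n r by simp
    have rate: "jackknife_rate r s n \<ge> 0" by (simp add: jackknife_rate_def)
    have "real (n - q) powr (- real (Suc q)) + (real (n - q) powr (- real s / 2) + real (n - q) powr (real q - real s))
        \<le> C * jackknife_rate r s n"
      unfolding C_def distrib_right r by (intro add_mono powr_le_jackknife_rate[OF n']) simp_all
    then have "M * (real (n - q) powr (- real (Suc q)) + (real (n - q) powr (- real s / 2) + real (n - q) powr (real q - real s)))
        \<le> M * (C * jackknife_rate r s n)"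
      using M by (rule mult_left_mono)
    with bias[OF D n' p] have "\<bar>jackknife_mean r n f p - f p\<bar> \<le> M * (C * jackknife_rate r s n)"
      unfolding r by linarith
    also have "\<dots> \<le> (M * C + 1) * jackknife_rate r s n"
      using rate by (simp add: algebra_simps)
    finally show "ereal \<bar>jackknife_mean r n f p - f p\<bar> \<le> ereal ((M * C + 1) * jackknife_rate r s n)"
      by simp
  qed
  moreover have "M * C + 1 > 0" using M C by (simp add: add_nonneg_pos)
  ultimately show ?thesis by blast
qed

end
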